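(* Let $(f_k)_{k\ge 2}$ be complex numbers such that, for $\lambda\in\mathbb{C}^*$, the germ $F_\lambda(z)=\lambda\bigl(z+\sum_{k\ge 2} f_k z^k\bigr)$ is defined and univalent on the unit disk $\mathbb{D}=\{|z|<1\}$, and let $H:\lambda\mapsto H_\lambda$ be its linearization as a function of the multiplier $\lambda$. For any $\varepsilon>0$ there exist $\rho>0$ and two connected closed sets $C^*$ and $C$ such that (a) $C^*\subset C\subset \mathbb{P}^1\mathbb{C}$, $\ \mathrm{meas}_2(\mathbb{C}\setminus C^* )\le \varepsilon$ and $\mathrm{meas}_1(C\cap \mathbb{S}^1)\ge 2\pi-\varepsilon$; (b) $H\in \mathcal{C}^1_{hol}(C,\mathcal{H}^\infty(\mathbb{D}_\rho))$; (b$^*$) $H\in \mathcal{C}^\infty_{hol}(C^*,\mathcal{H}^\infty(\mathbb{D}_\rho))$.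
   Context: **Linearization.** For $\lambda\in\mathbb{C}$ not a root of unity, $H_\lambda(z)=z+\sum_{k\ge2}h_k(\lambda)z^k$ is the power series with $h_1=1$ and, for $k\ge2$, $$h_k(\lambda)=\frac{1}{\lambda^{k-1}-1}\sum_{j=2}^{k} f_j\sum_{\epsilon\in(\mathbb{Z}_+)^j,\ \epsilon_1+\dots+\epsilon_j=k}h_{\epsilon_1}(\lambda)\cdots h_{\epsilon_j}(\lambda),$$ where $\mathbb{Z}_+$ is the set of positive integers. For $\lambda\ne 0$ it is the unique formal solution tangent to the identity of $F_\lambda\circ H_\lambda=H_\lambda\circ R_\lambda$, $R_\lambda(z)=\lambda z$. The recurrence also defines $H_0$ (the inverse of $z+\sum_{k\ge 2} f_kz^k$), and one sets $H_\infty(z)=z$. **Spaces.** $\mathbb{S}^1$ is the unit circle; $\mathrm{meas}_d$ is $d$-dimensional Lebesgue measure (arc length on $\mathbb{S}^1$ for $d=1$). $\mathbb{D}_\rho$ is the disk of radius $\rho$ centred at $0$, and $\mathcal{H}^\infty(\mathbb{D}_\rho)$ is the Banach space of bounded holomorphic functions on $\{|z|<\rho\}$ with the sup norm. Let $B$ be a complex Banach space and $C$ a compact subset of $\mathbb{C}$. A continuous $f:C\to B$ belongs to $\mathcal{C}^1_{hol}(C,B)$ if there is a continuous $f^{(1)}:C\to B$ such that for all $\lambda\in C$ and $\varepsilon>0$ there is $\delta>0$ such that for all $\lambda_1,\lambda_2\in C$ with $|\lambda_1-\lambda|<\delta$, $|\lambda_2-\lambda|<\delta$ one has $\|f(\lambda_2)-f(\lambda_1)-f^{(1)}(\lambda_1)(\lambda_2-\lambda_1)\|\le\varepsilon|\lambda_1-\lambda_2|$.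 It belongs to $\mathcal{C}^\infty_{hol}(C,B)$ if there are continuous $f^{(n)}:C\to B$ ($n\ge0$), $f^{(0)}=f$, such that for all $n,m\ge0$ the function $R^{(n,m)}(\lambda_1,\lambda_2)=\sum_{h=0}^m\frac{f^{(n+h)}(\lambda_1)}{h!}(\lambda_2-\lambda_1)^h-f^{(n)}(\lambda_2)$ satisfies: for all $\lambda\in C$, $\varepsilon>0$ there is $\delta>0$ such that $\|R^{(n,m)}(\lambda_1,\lambda_2)\|\le\varepsilon|\lambda_1-\lambda_2|^m$ whenever $\lambda_1,\lambda_2\in C$, $|\lambda_1-\lambda|<\delta$, $|\lambda_2-\lambda|<\delta$. For compact $C\subset\mathbb{P}^1\mathbb{C}$ the same local conditions are required in the standard charts ($\lambda$ near finite points, $1/\lambda$ near $\infty$). *)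

theory Defs
  imports "HOL-Analysis.Analysis"
begin

section \<open>The germs and their linearizations\<close>

text \<open>A sequence \<open>f\<close> enters only through its values \<open>f k\<close> with \<open>k \<ge> 2\<close>.\<close>

definition germ :: "(nat \<Rightarrow> complex) \<Rightarrow> complex \<Rightarrow> complex fps" where
  "germ f \<mu> = Abs_fps (\<lambda>k. \<mu> * (if k = 0 then 0 else if k = 1 then 1 else f k))"

definition univalent_on_unit_disk :: "complex fps \<Rightarrow> bool" where
  "univalent_on_unit_disk F \<longleftrightarrow>
     fps_conv_radius F \<ge> 1 \<and> inj_on (eval_fps F) (ball 0 1)"

definition pos_compositions :: "nat \<Rightarrow> nat \<Rightarrow> nat list set" where
  "pos_compositions j k = {es. length es = j \<and> (\<forall>e\<in>set es. 0 < e) \<and> sum_list es = k}"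

lemma pos_compositions_less:
  assumes "es \<in> pos_compositions j k" "2 \<le> j" "e \<in> set es"
  shows "e < k"
proof -
  from assms(3) obtain xs ys where es: "es = xs @ e # ys"
    by (meson split_list)
  have "xs \<noteq> [] \<or> ys \<noteq> []"
    using assms(1,2) es by (auto simp: pos_compositions_def)
  then have "0 < sum_list (xs @ ys)"
    using assms(1) es
    by (cases xs; cases ys) (auto simp: pos_compositions_def)
  then show ?thesis
    using assms(1) es by (auto simp: pos_compositions_def)
qed

text \<open>If \<open>\<mu>\<close> is a root of unity, some denominator vanishes and the values from there on are
  meaningless (division by \<open>0\<close>); roots of unity have to be excluded explicitly wherever this
  function is used.\<close>

function lin_coeff :: "(nat \<Rightarrow> complex) \<Rightarrow> complex \<Rightarrow> nat \<Rightarrow> complex" where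
  "lin_coeff f \<mu> k =
     (if k = 0 then 0 else if k = 1 then 1
      else 1 / (\<mu> ^ (k - 1) - 1) *
             (\<Sum>j = 2..k. f j * (\<Sum>es \<in> pos_compositions j k. prod_list (map (lin_coeff f \<mu>) es))))"
  by pat_completeness auto
termination
  by (relation "Wellfounded.measure (\<lambda>(f, \<mu>, k). k)") (auto intro: pos_compositions_less)

declare lin_coeff.simps [simp del]

definition root_of_unity :: "complex \<Rightarrow> bool" where
  "root_of_unity \<mu> \<longleftrightarrow> (\<exists>n>0. \<mu> ^ n = 1)"

section \<open>The Riemann sphere\<close>

text \<open>\<open>None\<close> is the point at infinity.\<close>

definition riemann_sphere :: "complex option topology" where
  "riemann_sphere = Alexandroff_compactification euclidean"

definition chart_at_infinity :: "complex \<Rightarrow> complex option" where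
  "chart_at_infinity w = (if w = 0 then None else Some (1 / w))"

definition linearization :: "(nat \<Rightarrow> complex) \<Rightarrow> complex option \<Rightarrow> complex fps" where
  "linearization f p = (case p of None \<Rightarrow> fps_X | Some \<mu> \<Rightarrow> Abs_fps (lin_coeff f \<mu>))"

definition arc_length :: "complex measure" where
  "arc_length = distr (restrict_space lborel {0..<2 * pi}) borel cis"

section \<open>The space of bounded holomorphic functions on a disk\<close>

text \<open>The radius \<open>\<rho>\<close> varies, so the space is given by a carrier and a norm. Elements are total
  functions of which only the restriction to the disk matters: the norm identifies functions that
  agree on the disk.\<close>

definition Hinf :: "real \<Rightarrow> (complex \<Rightarrow> complex) set" where
  "Hinf \<rho> = {g. g holomorphic_on ball 0 \<rho> \<and> bounded (g ` ball 0 \<rho>)}"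

definition Hinf_norm :: "real \<Rightarrow> (complex \<Rightarrow> complex) \<Rightarrow> real" where
  "Hinf_norm \<rho> g = (SUP z\<in>ball 0 \<rho>. norm (g z))"

section \<open>Holomorphic differentiability on closed sets\<close>

text \<open>Here \<open>B\<close> is the carrier of a Banach space of functions, with pointwise operations and
  norm \<open>nrm\<close>.\<close>

definition continuous_into ::
  "complex set \<Rightarrow> ('a \<Rightarrow> complex) set \<Rightarrow> (('a \<Rightarrow> complex) \<Rightarrow> real)
    \<Rightarrow> (complex \<Rightarrow> 'a \<Rightarrow> complex) \<Rightarrow> bool" where
  "continuous_into C B nrm u \<longleftrightarrow> (\<forall>\<mu>\<in>C. u \<mu> \<in> B) \<and>
     (\<forall>\<mu>\<in>C. \<forall>\<epsilon>>0. \<exists>\<delta>>0. \<forall>\<nu>\<in>C. norm (\<nu> - \<mu>) < \<delta> \<longrightarrow> nrm (\<lambda>z. u \<nu> z - u \<mu> z) < \<epsilon>)"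

definition C1_hol ::
  "complex set \<Rightarrow> ('a \<Rightarrow> complex) set \<Rightarrow> (('a \<Rightarrow> complex) \<Rightarrow> real)
    \<Rightarrow> (complex \<Rightarrow> 'a \<Rightarrow> complex) \<Rightarrow> bool" where
  "C1_hol C B nrm u \<longleftrightarrow> continuous_into C B nrm u \<and>
     (\<exists>u1. continuous_into C B nrm u1 \<and>
       (\<forall>\<mu>\<in>C. \<forall>\<epsilon>>0. \<exists>\<delta>>0. \<forall>\<mu>1\<in>C. \<forall>\<mu>2\<in>C.
          norm (\<mu>1 - \<mu>) < \<delta> \<longrightarrow> norm (\<mu>2 - \<mu>) < \<delta> \<longrightarrow>
          nrm (\<lambda>z. u \<mu>2 z - u \<mu>1 z - u1 \<mu>1 z * (\<mu>2 - \<mu>1)) \<le> \<epsilon> * norm (\<mu>1 - \<mu>2)))"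

definition taylor_remainder ::
  "(nat \<Rightarrow> complex \<Rightarrow> 'a \<Rightarrow> complex) \<Rightarrow> nat \<Rightarrow> nat \<Rightarrow> complex \<Rightarrow> complex \<Rightarrow> 'a \<Rightarrow> complex" where
  "taylor_remainder D n m \<mu>1 \<mu>2 z =
     (\<Sum>h = 0..m. D (n + h) \<mu>1 z / fact h * (\<mu>2 - \<mu>1) ^ h) - D n \<mu>2 z"

definition Cinf_hol ::
  "complex set \<Rightarrow> ('a \<Rightarrow> complex) set \<Rightarrow> (('a \<Rightarrow> complex) \<Rightarrow> real)
    \<Rightarrow> (complex \<Rightarrow> 'a \<Rightarrow> complex) \<Rightarrow> bool" where
  "Cinf_hol C B nrm u \<longleftrightarrow>
     (\<exists>D. (\<forall>n. continuous_into C B nrm (D n)) \<and> (\<forall>\<mu>\<in>C. D 0 \<mu> = u \<mu>) \<and>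
       (\<forall>n m. \<forall>\<mu>\<in>C. \<forall>\<epsilon>>0. \<exists>\<delta>>0. \<forall>\<mu>1\<in>C. \<forall>\<mu>2\<in>C.
          norm (\<mu>1 - \<mu>) < \<delta> \<longrightarrow> norm (\<mu>2 - \<mu>) < \<delta> \<longrightarrow>
          nrm (taylor_remainder D n m \<mu>1 \<mu>2) \<le> \<epsilon> * norm (\<mu>1 - \<mu>2) ^ m))"

text \<open>On the sphere: the coordinate \<open>\<mu>\<close> is used at the finite points, and \<open>w = 1 / \<mu>\<close>
  in a neighbourhood of infinity.\<close>

definition C1_hol_sphere ::
  "complex option set \<Rightarrow> ('a \<Rightarrow> complex) set \<Rightarrow> (('a \<Rightarrow> complex) \<Rightarrow> real)
    \<Rightarrow> (complex option \<Rightarrow> 'a \<Rightarrow> complex) \<Rightarrow> bool" where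
  "C1_hol_sphere C B nrm u \<longleftrightarrow>
     C1_hol {\<mu>. Some \<mu> \<in> C} B nrm (u \<circ> Some) \<and>
     (\<exists>r>0. C1_hol {w. norm w < r \<and> chart_at_infinity w \<in> C} B nrm (u \<circ> chart_at_infinity))"

definition Cinf_hol_sphere ::
  "complex option set \<Rightarrow> ('a \<Rightarrow> complex) set \<Rightarrow> (('a \<Rightarrow> complex) \<Rightarrow> real)
    \<Rightarrow> (complex option \<Rightarrow> 'a \<Rightarrow> complex) \<Rightarrow> bool" where
  "Cinf_hol_sphere C B nrm u \<longleftrightarrow>
     Cinf_hol {\<mu>. Some \<mu> \<in> C} B nrm (u \<circ> Some) \<and>
     (\<exists>r>0. Cinf_hol {w. norm w < r \<and> chart_at_infinity w \<in> C} B nrm (u \<circ> chart_at_infinity))"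

text \<open>\<open>H\<^sub>p\<close> is defined, as a power series converging on the disk of radius \<open>\<rho>\<close>, for every
  \<open>p\<close> in \<open>C\<close>. This is implicit in speaking of \<open>H\<close> as a function from \<open>C\<close> to \<open>Hinf \<rho>\<close>;
  \<open>eval_fps\<close> alone would yield junk values outside the disk of convergence.\<close>

definition linearization_defined_on ::
  "(nat \<Rightarrow> complex) \<Rightarrow> real \<Rightarrow> complex option set \<Rightarrow> bool" where
  "linearization_defined_on f \<rho> C \<longleftrightarrow>
     (\<forall>\<mu>. Some \<mu> \<in> C \<longrightarrow> \<not> root_of_unity \<mu>) \<and>
     (\<forall>p\<in>C. fps_conv_radius (linearization f p) \<ge> ereal \<rho>)"

end

theory Submission
  imports Defs "HOL-Complex_Analysis.Complex_Analysis" "HOL-Real_Asymp.Real_Asymp"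
begin

text \<open>
  The coefficients \<open>h\<^sub>k\<close> are rational functions of the multiplier \<open>\<mu>\<close>, with poles at the roots of
  unity of order below \<open>k\<close> only. This finiteness is what makes smoothness on a closed set accessible:
  if every point of the set satisfies \<open>\<bar>\<mu>\<^sup>n - 1\<bar> \<ge> \<gamma> / n\<^sup>2\<close> for all \<open>n \<ge> 1\<close>, then the same inequalities
  for \<open>n < k\<close>, with \<open>\<gamma>\<close> halved, persist on disks of radius \<open>\<delta>\<^sub>k\<close>, of size \<open>k\<^sup>-\<^sup>3\<close>, around those points
  (\<open>diophantine_neighbourhood\<close>). Siegel's estimate bounds \<open>\<bar>h\<^sub>k\<bar>\<close> by \<open>A\<^sup>k\<close> from the divisors with \<open>n < k\<close>
  alone (\<open>siegel_estimate\<close>), hence on these disks, with one \<open>A\<close> for all of them. Cauchy's inequalities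
  then bound the \<open>p\<close>-th derivative by a constant times \<open>A\<^sup>k \<delta>\<^sub>k\<^sup>-\<^sup>p\<close>, and Taylor remainders likewise: two
  points closer than \<open>\<delta>\<^sub>k / 2\<close> are treated by Taylor's formula in a common disk, while for points
  further apart \<open>1 \<le> 2 \<bar>\<mu>\<^sub>1 - \<mu>\<^sub>2\<bar> / \<delta>\<^sub>k\<close> makes the sup bounds sufficient. So no
  path joining the two points inside the set is ever used. The loss \<open>\<delta>\<^sub>k\<^sup>-\<^sup>p\<close> is polynomial in \<open>k\<close>
  and is absorbed by taking \<open>A \<rho> = 1 / 2\<close>; this gives all derivatives at once
  (\<open>Cinf_hol_power_series\<close>), and a single set can serve as both \<open>C\<^sup>*\<close> and \<open>C\<close>.

  That set consists of \<open>\<infinity>\<close>, of the \<open>\<mu>\<close> with \<open>\<bar>\<mu>\<bar> \<le> 1 - \<eta>\<close> or \<open>\<bar>\<mu>\<bar> \<ge> 1 + \<eta>\<close>, and of all rays from \<open>0\<close> through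
  the points \<open>\<zeta>\<close> of the unit circle with \<open>\<bar>\<zeta>\<^sup>n - 1\<bar> \<ge> \<gamma> / n\<^sup>2\<close> for all \<open>n \<ge> 1\<close>. The rays make it
  connected. Its complement lies in an annulus of area \<open>4 \<pi> \<eta>\<close>, and the part of the circle that it misses
  is covered by intervals around the roots of unity with total length a multiple of \<open>\<gamma>\<close>
  (\<open>arc_length_diophantine\<close>). On a ray the small divisors stay
  controlled because the distance from \<open>1\<close> to the line through \<open>0\<close> and \<open>\<mu>\<^sup>n\<close> is governed by \<open>\<zeta>\<^sup>2\<^sup>n\<close>
  (\<open>norm_minus_1_ge_ray\<close>). In the chart at infinity the divisors are \<open>w\<^sup>-\<^sup>n - 1\<close> and are not small, so the
  coefficients are holomorphic and geometrically bounded in a fixed disk around \<open>w = 0\<close>.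

  Siegel's estimate rests on the remark that if \<open>\<mu>\<^sup>s\<close> and \<open>\<mu>\<^sup>t\<close> are both close to \<open>1\<close>, so is \<open>\<mu>\<^sup>t\<^sup>-\<^sup>s\<close>: the
  indices at which the divisor falls below a given threshold are separated by long gaps. Unfolding the recurrence
  yields trees in which a subtree with \<open>e\<close> leaves carries the divisor of index \<open>e - 1\<close>, and the gaps bound the number
  of bad divisors in a tree (\<open>divisor_budget_step\<close>). Summing over dyadic
  thresholds bounds the product of all inverse divisors in a tree geometrically in the number of leaves, and the number of trees is
  geometric too (\<open>majorant_sum_le\<close>).
\<close>

section \<open>Counting small divisors in a composition tree\<close>

text \<open>For a set \<open>S\<close> with gaps \<open>q\<close> this function follows the identity, except that it stays constant on the last
  stretch of length \<open>q / 2\<close> before each point of \<open>S\<close> and then catches up by a jump of at least \<open>q / 2\<close>.\<close>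

definition plateau :: "nat set \<Rightarrow> real \<Rightarrow> nat \<Rightarrow> real" where
  "plateau S q n = Inf (insert (real n) {real s - q / 2 | s. s \<in> S \<and> n < s})"

text \<open>An upper bound for the number of nodes with index in \<open>S\<close> in a tree whose root has index \<open>n\<close>. The jumps
  of \<open>plateau\<close> raise the budget by at least \<open>1\<close> at the points of \<open>S\<close>; the term \<open>- 1\<close> pays for the
  root when two or more subtrees contain bad nodes.\<close>

definition divisor_budget :: "nat set \<Rightarrow> real \<Rightarrow> nat \<Rightarrow> real" where
  "divisor_budget S q n = max 0 (2 * plateau S q n / q - 1)"

definition gapped :: "real \<Rightarrow> nat set \<Rightarrow> bool" where
  "gapped q S \<longleftrightarrow> 0 < q \<and> (\<forall>s\<in>S. q \<le> real s) \<and> (\<forall>s\<in>S. \<forall>t\<in>S. s < t \<longrightarrow> q \<le> real (t - s))"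

lemma plateau_set_bdd_below: "bdd_below (insert (real n) {real s - q / 2 | s. s \<in> S \<and> n < s})"
proof (rule bdd_belowI)
  fix x assume "x \<in> insert (real n) {real s - q / 2 | s. s \<in> S \<and> n < s}"
  then show "real n - \<bar>q\<bar> \<le> x" by (auto simp: abs_if field_simps)
qed

lemma plateau_le: "plateau S q n \<le> real n"
  unfolding plateau_def using plateau_set_bdd_below by (rule cInf_lower[rotated]) simp

lemma plateau_le_before: "s \<in> S \<Longrightarrow> n < s \<Longrightarrow> plateau S q n \<le> real s - q / 2"
  unfolding plateau_def using plateau_set_bdd_below by (rule cInf_lower[rotated]) auto

lemma plateau_ge:
  assumes "0 \<le> q" shows "real n - q / 2 \<le> plateau S q n"
  unfolding plateau_def by (rule cInf_greatest) (use assms in auto)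

lemma plateau_mono:
  assumes "m \<le> n" shows "plateau S q m \<le> plateau S q n"
  unfolding plateau_def[of S q n]
proof (rule cInf_greatest)
  fix x assume "x \<in> insert (real n) {real s - q / 2 | s. s \<in> S \<and> n < s}"
  then show "plateau S q m \<le> x"
    using plateau_le[of S q m] plateau_le_before[of _ S m q] assms by fastforce
qed simp

text \<open>The gap condition keeps the stretch before the next point of \<open>S\<close> away from \<open>n\<close>.\<close>

lemma plateau_mem:
  assumes "gapped q S" "n \<in> S" shows "plateau S q n = real n"
proof (rule antisym[OF plateau_le])
  show "real n \<le> plateau S q n"
    unfolding plateau_def
  proof (rule cInf_greatest)
    fix x assume "x \<in> insert (real n) {real s - q / 2 | s. s \<in> S \<and> n < s}"
    then show "real n \<le> x"
    proof
      assume "x \<in> {real s - q / 2 | s. s \<in> S \<and> n < s}"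
      then obtain s where s: "x = real s - q / 2" "s \<in> S" "n < s" by blast
      then have "q \<le> real (s - n)" "0 < q" using assms unfolding gapped_def by blast+
      then show ?thesis using s by (simp add: of_nat_diff)
    qed simp
  qed simp
qed

lemma divisor_budget_nonneg: "0 \<le> divisor_budget S q n"
  by (simp add: divisor_budget_def)

lemma divisor_budget_le:
  assumes "0 < q" shows "divisor_budget S q n \<le> 2 * real n / q"
proof -
  have "2 * plateau S q n / q \<le> 2 * real n / q"
    using assms plateau_le by (intro divide_right_mono) auto
  moreover have "0 \<le> 2 * real n / q" using assms by simp
  ultimately show ?thesis unfolding divisor_budget_def by linarith
qed

text \<open>Every nonzero budget is below \<open>2 n / q - 1\<close>, so two nonzero terms in a sum already save \<open>2\<close>.\<close>

lemma divisor_budget_sum_cases: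
  assumes "0 < q"
  shows "sum_list (map (divisor_budget S q) ns) = 0
       \<or> (\<exists>n\<in>set ns. sum_list (map (divisor_budget S q) ns) = divisor_budget S q n)
       \<or> sum_list (map (divisor_budget S q) ns) \<le> 2 * real (sum_list ns) / q - 2"
proof (induction ns)
  case (Cons a ns)
  let ?b = "divisor_budget S q"
  let ?s = "sum_list (map ?b ns)"
  have pos: "?b n \<le> 2 * real n / q - 1" if "?b n \<noteq> 0" for n
  proof -
    have "2 * plateau S q n / q \<le> 2 * real n / q"
      using assms plateau_le by (intro divide_right_mono) auto
    then show ?thesis using that unfolding divisor_budget_def by linarith
  qed
  have split: "2 * real (sum_list (a # ns)) / q = 2 * real a / q + 2 * real (sum_list ns) / q"
    by (simp add: add_divide_distrib)
  have a0: "0 \<le> 2 * real a / q" using assms by simp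
  show ?case
  proof (cases "?b a = 0")
    case True
    with Cons.IH a0 split show ?thesis by auto
  next
    case False
    note fa = pos[OF False]
    from Cons.IH consider "?s = 0" | n where "n \<in> set ns" "?s = ?b n" "?b n \<noteq> 0"
      | "?s \<le> 2 * real (sum_list ns) / q - 2" by metis
    then show ?thesis
    proof cases
      case 1 then show ?thesis by auto
    next
      case (2 n)
      have "real n \<le> real (sum_list ns)" using member_le_sum_list[OF 2(1)] by simp
      then have "2 * real n / q \<le> 2 * real (sum_list ns) / q"
        using assms by (intro divide_right_mono) auto
      with pos[OF 2(3)] fa 2(2) split show ?thesis by auto
    next
      case 3
      with fa split show ?thesis by auto
    qed
  qed
qed simp

text \<open>The induction step of the count. The list \<open>es\<close> gives the numbers of leaves of the subtrees
  at a node; since there are at least two of them, their indices add up to less than the index of the node. If no subtree has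
  a budget, a bad root has index at least \<open>q\<close> and pays for itself; if one has, the jump
  of \<open>plateau\<close> pays; if several have, the units saved in the sum over the subtrees pay.\<close>

lemma divisor_budget_step:
  assumes S: "gapped q S" and len: "2 \<le> length es" and pos: "\<forall>e\<in>set es. 0 < e"
  shows "sum_list (map (\<lambda>e. divisor_budget S q (e - 1)) es) + of_bool (sum_list es - 1 \<in> S)
           \<le> divisor_budget S q (sum_list es - 1)"
proof -
  define ns where "ns = map (\<lambda>e. e - 1) es"
  define n where "n = sum_list es - 1"
  let ?b = "divisor_budget S q"
  have q: "0 < q" using S by (simp add: gapped_def)
  have "sum_list es = sum_list ns + length es"
    using pos unfolding ns_def by (induction es) auto
  then have sm: "sum_list ns < n" using len unfolding n_def by linarith
  have eq: "sum_list (map (\<lambda>e. ?b (e - 1)) es) = sum_list (map ?b ns)"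
    unfolding ns_def by (simp add: comp_def)
  have inS: "?b n = 2 * real n / q - 1" "1 \<le> ?b n" if "n \<in> S"
  proof -
    have "q \<le> real n" using S that by (auto simp: gapped_def)
    then have "2 \<le> 2 * real n / q" using q by (simp add: field_simps)
    then show "?b n = 2 * real n / q - 1" "1 \<le> ?b n"
      unfolding divisor_budget_def using plateau_mem[OF S that] by simp_all
  qed
  have "sum_list (map ?b ns) + of_bool (n \<in> S) \<le> ?b n"
    using divisor_budget_sum_cases[OF q, of S ns]
  proof (elim disjE bexE)
    assume "sum_list (map ?b ns) = 0"
    then show ?thesis using inS divisor_budget_nonneg[of S q n] by (cases "n \<in> S") auto
  next
    fix m assume m: "m \<in> set ns" and eqm: "sum_list (map ?b ns) = ?b m"
    have mn: "m < n" using member_le_sum_list[OF m] sm by simp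
    show ?thesis
    proof (cases "n \<in> S")
      case True
      have "2 * plateau S q m / q \<le> 2 * (real n - q / 2) / q"
        using plateau_le_before[OF True mn, of q] q by (intro divide_right_mono) auto
      also have "\<dots> = 2 * real n / q - 1" using q by (simp add: field_simps)
      finally have "?b m + 1 \<le> ?b n"
        using inS[OF True] unfolding divisor_budget_def[of S q m] by linarith
      then show ?thesis using eqm True by simp
    next
      case False
      have "2 * plateau S q m / q \<le> 2 * plateau S q n / q"
        using plateau_mono[of m n S q] mn q by (intro divide_right_mono) auto
      then show ?thesis using eqm False unfolding divisor_budget_def by auto
    qed
  next
    assume le: "sum_list (map ?b ns) \<le> 2 * real (sum_list ns) / q - 2"
    have "2 * real (sum_list ns) / q \<le> 2 * real n / q"
      using sm q by (intro divide_right_mono) auto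
    moreover have "2 * real n / q - 2 \<le> ?b n"
    proof -
      have "2 * (real n - q / 2) / q \<le> 2 * plateau S q n / q"
        using plateau_ge[of q n S] q by (intro divide_right_mono) auto
      moreover have "2 * (real n - q / 2) / q = 2 * real n / q - 1" using q by (simp add: field_simps)
      ultimately show ?thesis unfolding divisor_budget_def by linarith
    qed
    ultimately show ?thesis using le inS by (cases "n \<in> S") auto
  qed
  then show ?thesis unfolding eq n_def .
qed

section \<open>The majorant series\<close>

lemma finite_pos_compositions: "finite (pos_compositions j k)"
proof (rule finite_subset)
  show "pos_compositions j k \<subseteq> {xs. set xs \<subseteq> {..k} \<and> length xs = j}"
    using member_le_sum_list by (auto simp: pos_compositions_def)
qed (simp add: finite_lists_length_eq)

lemma power_sum_eq_sum_lists:
  fixes b :: "nat \<Rightarrow> real"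
  assumes "finite I"
  shows "(\<Sum>i\<in>I. b i) ^ j = (\<Sum>es | set es \<subseteq> I \<and> length es = j. prod_list (map b es))"
proof (induction j)
  case 0
  have "{es. set es \<subseteq> I \<and> length es = 0} = {[]}" by auto
  then show ?case by simp
next
  case (Suc j)
  let ?L = "\<lambda>j. {es. set es \<subseteq> I \<and> length es = j}"
  have img: "?L (Suc j) = (\<lambda>(x, xs). x # xs) ` (I \<times> ?L j)"
    by (auto simp: length_Suc_conv image_iff)
  have inj: "inj_on (\<lambda>(x, xs). x # xs) (I \<times> ?L j)" by (auto simp: inj_on_def)
  have "(\<Sum>es\<in>?L (Suc j). prod_list (map b es)) = (\<Sum>(x, xs)\<in>I \<times> ?L j. b x * prod_list (map b xs))"
    unfolding img by (subst sum.reindex[OF inj]) (auto intro!: sum.cong)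
  also have "\<dots> = (\<Sum>x\<in>I. \<Sum>xs\<in>?L j. b x * prod_list (map b xs))"
    by (subst sum.cartesian_product) simp
  also have "\<dots> = (\<Sum>x\<in>I. b x) * (\<Sum>xs\<in>?L j. prod_list (map b xs))"
    by (simp add: sum_product)
  finally show ?case using Suc by simp
qed

text \<open>A composition of \<open>k \<le> n + 1\<close> into at least two parts has all its parts in \<open>{1..n}\<close>, so the left-hand
  side collects some of the terms of the expanded power. This lets the partial sums of the majorant be bounded
  inductively, without any convergence statement.\<close>

lemma sum_pos_compositions_le_power:
  fixes b :: "nat \<Rightarrow> real"
  assumes nonneg: "\<And>i. 0 \<le> b i" and j: "2 \<le> j"
  shows "(\<Sum>k = 2..Suc n. \<Sum>es\<in>pos_compositions j k. prod_list (map b es)) \<le> (\<Sum>i = 1..n. b i) ^ j"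
proof -
  have "(\<Sum>k = 2..Suc n. \<Sum>es\<in>pos_compositions j k. prod_list (map b es))
      = (\<Sum>es\<in>(\<Union>k\<in>{2..Suc n}. pos_compositions j k). prod_list (map b es))"
    by (rule sum.UNION_disjoint[symmetric])
       (simp_all add: finite_pos_compositions, auto simp: pos_compositions_def)
  also have "\<dots> \<le> (\<Sum>es | set es \<subseteq> {1..n} \<and> length es = j. prod_list (map b es))"
  proof (rule sum_mono2)
    show "(\<Union>k\<in>{2..Suc n}. pos_compositions j k) \<subseteq> {es. set es \<subseteq> {1..n} \<and> length es = j}"
    proof (clarsimp, intro conjI subsetI)
      fix es k e assume k: "2 \<le> k" "k \<le> Suc n" and es: "es \<in> pos_compositions j k" and "e \<in> set es"
      then show "e \<in> {Suc 0..n}"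
        using pos_compositions_less[OF es j, of e] by (auto simp: pos_compositions_def Suc_le_eq)
    qed (auto simp: pos_compositions_def)
  qed (auto simp: finite_lists_length_eq intro!: prod_list_nonneg nonneg)
  also have "\<dots> = (\<Sum>i = 1..n. b i) ^ j" by (simp add: power_sum_eq_sum_lists)
  finally show ?thesis .
qed

lemma pos_compositions_empty: "k < j \<Longrightarrow> pos_compositions j k = {}"
proof -
  have "length es \<le> sum_list es" if "\<forall>e\<in>set es. 0 < e" for es :: "nat list"
    using that by (induction es) auto
  then show "k < j \<Longrightarrow> pos_compositions j k = {}"
    by (fastforce simp: pos_compositions_def)
qed

lemma prod_list_map_mult:
  "prod_list (map (\<lambda>e. u e * v e) es) = prod_list (map u es) * prod_list (map v es)"
  for u v :: "'a \<Rightarrow> 'b::comm_monoid_mult"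
  by (induction es) (auto simp: mult_ac)

lemma prod_list_map_power: "prod_list (map (\<lambda>e. x ^ e) es) = x ^ sum_list es"
  for x :: "'a::comm_monoid_mult"
  by (induction es) (auto simp: power_add)

text \<open>The partial sums \<open>T\<^sub>n\<close> at \<open>x = 1 / (10 B)\<close> obey \<open>T\<^sub>n\<^sub>+\<^sub>1 \<le> x + 2 \<Sum>\<^sub>j\<^sub>\<ge>\<^sub>2 B\<^sup>j\<^sup>-\<^sup>1 T\<^sub>n\<^sup>j\<close>. With \<open>T\<^sub>n \<le> 2 x\<close>
  the sum over \<open>j\<close> is a geometric series of ratio \<open>2 B x = 1 / 5\<close>, equal to \<open>x / 2\<close>, so \<open>T\<^sub>n\<^sub>+\<^sub>1 \<le> 2 x\<close> again.\<close>

lemma majorant_sum_le: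
  fixes a :: "nat \<Rightarrow> real" and B :: real
  assumes B: "0 < B" and nonneg: "\<And>k. 0 \<le> a k" and one: "a 1 \<le> 1"
    and rec: "\<And>k. 2 \<le> k \<Longrightarrow> k \<le> N \<Longrightarrow>
      a k \<le> 2 * (\<Sum>j = 2..k. B ^ (j - 1) * (\<Sum>es\<in>pos_compositions j k. prod_list (map a es)))"
    and n: "n \<le> N"
  shows "(\<Sum>i = 1..n. a i * (1 / (10 * B)) ^ i) \<le> 2 * (1 / (10 * B))"
  using n
proof (induction n)
  case 0
  then show ?case using B by simp
next
  case (Suc n)
  define x where "x = 1 / (10 * B)"
  have x: "0 < x" using B by (simp add: x_def)
  define b where "b = (\<lambda>i. a i * x ^ i)"
  have b0: "0 \<le> b i" for i using nonneg x by (simp add: b_def)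
  have IH: "(\<Sum>i = 1..n. b i) \<le> 2 * x" using Suc by (simp add: b_def x_def)
  have step: "b k \<le> 2 * (\<Sum>j = 2..Suc n. B ^ (j - 1) * (\<Sum>es\<in>pos_compositions j k. prod_list (map b es)))"
    if k: "k \<in> {2..Suc n}" for k
  proof -
    have pb: "prod_list (map b es) = prod_list (map a es) * x ^ k" if "es \<in> pos_compositions j k" for es j
      using that unfolding b_def
      by (auto simp: prod_list_map_mult prod_list_map_power pos_compositions_def)
    have "b k \<le> 2 * (\<Sum>j = 2..k. B ^ (j - 1) * (\<Sum>es\<in>pos_compositions j k. prod_list (map a es))) * x ^ k"
      unfolding b_def using rec[of k] k Suc.prems x by (intro mult_right_mono) auto
    also have "\<dots> = 2 * (\<Sum>j = 2..k. B ^ (j - 1) * (\<Sum>es\<in>pos_compositions j k. prod_list (map b es)))"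
      by (simp add: sum_distrib_right sum_distrib_left mult.assoc pb)
    also have "\<dots> = 2 * (\<Sum>j = 2..Suc n. B ^ (j - 1) * (\<Sum>es\<in>pos_compositions j k. prod_list (map b es)))"
      using k by (intro arg_cong[where f = "\<lambda>t. 2 * t"] sum.mono_neutral_left)
        (auto simp: pos_compositions_empty)
    finally show ?thesis .
  qed
  have geo: "(\<Sum>j = 2..Suc n. (1 / 5 :: real) ^ (j - 1)) \<le> 1 / 4"
  proof -
    have "(\<Sum>j = 2..Suc n. (1 / 5 :: real) ^ (j - 1)) = (\<Sum>j = 1..n. (1 / 5) ^ j)"
      using sum.shift_bounds_cl_Suc_ivl[of "\<lambda>j. (1 / 5 :: real) ^ (j - 1)" 1 n]
      by (simp add: numeral_2_eq_2)
    also have "\<dots> = 1 / 4 * (1 - (1 / 5) ^ n)"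
      by (induction n) (auto simp: algebra_simps)
    also have "\<dots> \<le> 1 / 4" by simp
    finally show ?thesis .
  qed
  have "(\<Sum>i = 1..Suc n. b i) = b 1 + (\<Sum>i = 2..Suc n. b i)"
    by (subst sum.atLeast_Suc_atMost) (auto simp: numeral_2_eq_2)
  also have "b 1 \<le> x" using one x by (simp add: b_def)
  also have "(\<Sum>k = 2..Suc n. b k)
      \<le> (\<Sum>k = 2..Suc n. 2 * (\<Sum>j = 2..Suc n. B ^ (j - 1) * (\<Sum>es\<in>pos_compositions j k. prod_list (map b es))))"
    by (rule sum_mono) (rule step)
  also have "\<dots> = 2 * (\<Sum>j = 2..Suc n. B ^ (j - 1) * (\<Sum>k = 2..Suc n. \<Sum>es\<in>pos_compositions j k. prod_list (map b es)))"
    unfolding sum_distrib_left by (rule sum.swap)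
  also have "\<dots> \<le> 2 * (\<Sum>j = 2..Suc n. 2 * x * (1 / 5) ^ (j - 1))"
  proof (intro mult_left_mono sum_mono)
    fix j assume j: "j \<in> {2..Suc n}"
    then obtain i where i: "j = Suc i" by (cases j) auto
    have "B ^ (j - 1) * (\<Sum>k = 2..Suc n. \<Sum>es\<in>pos_compositions j k. prod_list (map b es))
        \<le> B ^ (j - 1) * (\<Sum>i = 1..n. b i) ^ j"
      using j B sum_pos_compositions_le_power[of b j n] b0 by (intro mult_left_mono) auto
    also have "\<dots> \<le> B ^ (j - 1) * (2 * x) ^ j"
      using IH B b0 by (intro mult_left_mono power_mono sum_nonneg) auto
    also have "\<dots> = 2 * x * (B * (2 * x)) ^ i"
      unfolding i power_mult_distrib by simp
    also have "B * (2 * x) = 1 / 5" using B by (simp add: x_def)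
    finally show "B ^ (j - 1) * (\<Sum>k = 2..Suc n. \<Sum>es\<in>pos_compositions j k. prod_list (map b es))
        \<le> 2 * x * (1 / 5) ^ (j - 1)" by (simp add: i)
  qed simp
  also have "\<dots> = 4 * x * (\<Sum>j = 2..Suc n. (1 / 5) ^ (j - 1))"
    unfolding sum_distrib_left by (simp add: mult_ac del: sum.cl_ivl_Suc)
  also have "\<dots> \<le> 4 * x * (1 / 4)" using geo x by (intro mult_left_mono) auto
  finally show ?case unfolding b_def x_def by simp
qed

text \<open>Dividing by weights \<open>W\<close> that dominate the divisors along the recurrence removes the divisors: \<open>\<bar>h\<^sub>k\<bar> / W\<^sub>k\<close>
  satisfies a recurrence with constant coefficients. The factor \<open>2\<close> in the hypothesis on \<open>W\<close> is
  room for divisors that are not small.\<close>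

lemma weighted_majorant_bound:
  fixes h d f :: "nat \<Rightarrow> complex" and W :: "nat \<Rightarrow> real"
  assumes B: "0 < B" "\<And>j. 2 \<le> j \<Longrightarrow> norm (f j) \<le> B ^ (j - 1)"
    and W: "\<And>k. 0 < W k" "1 \<le> W 1"
    and h1: "h 1 = 1"
    and rec: "\<And>k. 2 \<le> k \<Longrightarrow> k \<le> N \<Longrightarrow>
      h k = d k * (\<Sum>j = 2..k. f j * (\<Sum>es\<in>pos_compositions j k. prod_list (map h es)))"
    and dW: "\<And>k j es. 2 \<le> j \<Longrightarrow> j \<le> k \<Longrightarrow> k \<le> N \<Longrightarrow> es \<in> pos_compositions j k \<Longrightarrow>
      norm (d k) * prod_list (map W es) \<le> 2 * W k"
    and k: "1 \<le> k" "k \<le> N"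
  shows "norm (h k) \<le> 2 * W k * (10 * B) ^ (k - 1)"
proof -
  define a where "a = (\<lambda>k. norm (h k) / W k)"
  have a0: "0 \<le> a k" for k using W(1)[of k] by (simp add: a_def)
  have norm_prod: "norm (prod_list (map h es)) = prod_list (map a es) * prod_list (map W es)" for es
  proof (induction es)
    case (Cons e es)
    have "norm (h e) = a e * W e" using W(1)[of e] by (simp add: a_def)
    with Cons show ?case by (simp add: norm_mult mult_ac)
  qed simp
  have step: "a k \<le> 2 * (\<Sum>j = 2..k. B ^ (j - 1) * (\<Sum>es\<in>pos_compositions j k. prod_list (map a es)))"
    if k: "2 \<le> k" "k \<le> N" for k
  proof -
    have "norm (h k) \<le> norm (d k) * (\<Sum>j = 2..k. B ^ (j - 1) *
        (\<Sum>es\<in>pos_compositions j k. prod_list (map a es) * prod_list (map W es)))"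
      unfolding rec[OF k] norm_mult
    proof (intro mult_left_mono sum_norm_le)
      fix j assume j: "j \<in> {2..k}"
      show "norm (f j * (\<Sum>es\<in>pos_compositions j k. prod_list (map h es)))
        \<le> B ^ (j - 1) * (\<Sum>es\<in>pos_compositions j k. prod_list (map a es) * prod_list (map W es))"
        unfolding norm_mult using B j
        by (intro mult_mono sum_norm_le) (auto simp: norm_prod)
    qed simp
    also have "\<dots> = (\<Sum>j = 2..k. B ^ (j - 1) *
        (\<Sum>es\<in>pos_compositions j k. prod_list (map a es) * (norm (d k) * prod_list (map W es))))"
      by (simp add: sum_distrib_left mult_ac)
    also have "\<dots> \<le> (\<Sum>j = 2..k. B ^ (j - 1) *
        (\<Sum>es\<in>pos_compositions j k. prod_list (map a es) * (2 * W k)))"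
    proof (intro sum_mono mult_left_mono)
      fix j es assume "j \<in> {2..k}" "es \<in> pos_compositions j k"
      then show "norm (d k) * prod_list (map W es) \<le> 2 * W k" using dW[of j k es] k by simp
    qed (use B in \<open>auto intro!: prod_list_nonneg a0\<close>)
    also have "\<dots> = 2 * (\<Sum>j = 2..k. B ^ (j - 1) *
        (\<Sum>es\<in>pos_compositions j k. prod_list (map a es))) * W k"
      by (simp add: sum_distrib_left sum_distrib_right mult_ac)
    finally have "norm (h k) / W k \<le> 2 * (\<Sum>j = 2..k. B ^ (j - 1) *
        (\<Sum>es\<in>pos_compositions j k. prod_list (map a es)))"
      using W(1)[of k] by (simp add: divide_le_eq)
    then show ?thesis by (simp add: a_def)
  qed
  have a1: "a 1 \<le> 1" using h1 W by (simp add: a_def)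
  have "(\<Sum>i = 1..k. a i * (1 / (10 * B)) ^ i) \<le> 2 * (1 / (10 * B))"
    by (rule majorant_sum_le[OF B(1) a0 a1 step k(2)])
  moreover have "a k * (1 / (10 * B)) ^ k \<le> (\<Sum>i = 1..k. a i * (1 / (10 * B)) ^ i)"
    using k a0 B by (intro member_le_sum) auto
  ultimately have "a k * (1 / (10 * B)) ^ k \<le> 2 * (1 / (10 * B))" by linarith
  moreover obtain i where i: "k = Suc i" using k by (cases k) auto
  ultimately have "a k \<le> 2 * (10 * B) ^ i" using B by (simp add: field_simps)
  then show ?thesis unfolding a_def i using W(1)[of "Suc i"] by (simp add: field_simps)
qed

section \<open>Siegel's estimate\<close>

text \<open>From \<open>\<mu>\<^sup>s (\<mu>\<^sup>t\<^sup>-\<^sup>s - 1) = (\<mu>\<^sup>t - 1) - (\<mu>\<^sup>s - 1)\<close>. The restriction \<open>\<theta> \<le> 1 / 2\<close> keeps \<open>\<bar>\<mu>\<^sup>s\<bar> \<ge> 1 / 2\<close>, which is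
  how multipliers of modulus different from \<open>1\<close> are covered as well.\<close>

lemma small_divisors_gap:
  fixes \<mu> :: complex
  assumes st: "s < t" and s: "norm (\<mu> ^ s - 1) < \<theta>" and t: "norm (\<mu> ^ t - 1) < \<theta>" and \<theta>: "\<theta> \<le> 1 / 2"
  shows "norm (\<mu> ^ (t - s) - 1) \<le> 4 * \<theta>"
proof -
  have half: "1 / 2 \<le> norm (\<mu> ^ s)"
    using norm_triangle_ineq4[of "\<mu> ^ s" "\<mu> ^ s - 1"] s \<theta> by simp
  have "\<mu> ^ s * (\<mu> ^ (t - s) - 1) = (\<mu> ^ t - 1) - (\<mu> ^ s - 1)"
    using st by (simp add: algebra_simps flip: power_add)
  then have "norm (\<mu> ^ s) * norm (\<mu> ^ (t - s) - 1) \<le> norm (\<mu> ^ t - 1) + norm (\<mu> ^ s - 1)"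
    by (metis norm_mult norm_triangle_ineq4)
  moreover have "1 / 2 * norm (\<mu> ^ (t - s) - 1) \<le> norm (\<mu> ^ s) * norm (\<mu> ^ (t - s) - 1)"
    using half by (rule mult_right_mono) simp
  ultimately show ?thesis using s t by linarith
qed

text \<open>Turns the size of one divisor into the number of dyadic thresholds that it violates, so that
  divisors can be counted threshold by threshold.\<close>

lemma inverse_le_dyadic_count:
  fixes x :: real
  assumes "(1 / 2) ^ Suc M \<le> x"
  shows "1 / x \<le> 2 * 2 powr (\<Sum>m<M. of_bool (x < (1 / 2) ^ Suc m))"
  using assms
proof (induction M)
  case 0
  then show ?case by (simp add: field_simps)
next
  case (Suc M)
  show ?case
  proof (cases "(1 / 2) ^ Suc M \<le> x")
    case True
    then show ?thesis using Suc.IH by (simp add: not_less)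
  next
    case False
    have "x < (1 / 2) ^ Suc m" if "m \<le> M" for m
    proof -
      have "(1 / 2 :: real) ^ Suc M \<le> (1 / 2) ^ Suc m"
        using that by (intro power_decreasing) auto
      then show ?thesis using False by linarith
    qed
    then have "(\<Sum>m<Suc M. of_bool (x < (1 / 2) ^ Suc m)) = (\<Sum>m<Suc M. 1 :: real)"
      by (intro sum.cong) auto
    then have c: "2 powr (\<Sum>m<Suc M. of_bool (x < (1 / 2) ^ Suc m)) = (2 :: real) ^ Suc M"
      by (simp del: power_Suc add: powr_realpow flip: of_nat_Suc)
    have "0 < x" using Suc.prems by (rule less_le_trans[rotated]) simp
    moreover have "1 \<le> x * 2 ^ Suc (Suc M)"
      using mult_right_mono[OF Suc.prems, of "2 ^ Suc (Suc M)"]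
      by (simp add: power_divide del: power_Suc)
    ultimately show ?thesis unfolding c by (simp add: field_simps)
  qed
qed

lemma sum_list_map_sum: "sum_list (map (\<lambda>e. \<Sum>m\<in>I. u m e) es) = (\<Sum>m\<in>I. sum_list (map (u m) es))"
  for u :: "'b \<Rightarrow> 'a \<Rightarrow> 'c::comm_monoid_add"
  by (induction es) (auto simp: sum.distrib)

lemma prod_list_map_powr:
  "prod_list (map (\<lambda>e. b powr u e) es) = b powr sum_list (map u es)" if "0 < b" for b :: real
  using that by (induction es) (auto simp: powr_add)

text \<open>At threshold \<open>2\<^sup>-\<^sup>m\<^sup>-\<^sup>1\<close> the bad indices have gaps \<open>q\<^sub>m\<close> proportional to \<open>2\<^sup>m\<^sup>/\<^sup>2\<close>, so a tree of index \<open>n\<close>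
  contains at most \<open>2 n / q\<^sub>m\<close> of them. As \<open>\<Sum>\<^sub>m 2 / q\<^sub>m\<close> converges, the weights \<open>2\<close> to the power of the total budget grow
  geometrically. The lower bound on the divisors is assumed for \<open>n < k\<close> only, as those are the divisors that occur in \<open>h\<^sub>k\<close>, and
  \<open>A\<close> does not depend on \<open>\<mu>\<close>.\<close>

lemma siegel_estimate:
  fixes f :: "nat \<Rightarrow> complex" and B \<gamma> :: real
  assumes B: "1 \<le> B" "\<And>j. 2 \<le> j \<Longrightarrow> norm (f j) \<le> B ^ (j - 1)" and \<gamma>: "0 < \<gamma>"
  obtains A where "1 \<le> A"
    "\<And>\<mu> k. (\<And>n. 1 \<le> n \<Longrightarrow> n < k \<Longrightarrow> \<gamma> / real n ^ 2 \<le> norm (\<mu> ^ n - 1)) \<Longrightarrow> norm (lin_coeff f \<mu> k) \<le> A ^ k"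
proof -
  define q where "q = (\<lambda>m::nat. sqrt (\<gamma> * 2 ^ m / 2))"
  have q0: "0 < q m" for m using \<gamma> by (simp add: q_def)
  have q_eq: "2 / q m = 2 / sqrt (\<gamma> / 2) * (1 / sqrt 2) ^ m" for m
    by (simp add: q_def real_sqrt_mult real_sqrt_divide real_sqrt_power power_divide field_simps)
  have summ: "summable (\<lambda>m. 2 / q m)"
    unfolding q_eq by (intro summable_mult summable_geometric) simp
  define L where "L = (\<Sum>m. 2 / q m)"
  have L0: "0 \<le> L" unfolding L_def using summ q0 by (intro suminf_nonneg) (auto simp: less_imp_le)
  define A where "A = 2 * 2 powr L * (10 * B)"
  have "1 \<le> 2 powr L" using L0 by (simp add: ge_one_powr_ge_zero)
  then have A1: "1 \<le> A" unfolding A_def using B(1) mult_mono[of 1 "2 powr L" 1 B] by simp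
  have "norm (lin_coeff f \<mu> k) \<le> A ^ k"
    if dioph: "\<And>n. 1 \<le> n \<Longrightarrow> n < k \<Longrightarrow> \<gamma> / real n ^ 2 \<le> norm (\<mu> ^ n - 1)" for \<mu> k
  proof (cases "k = 0")
    case True
    then show ?thesis by (simp add: lin_coeff.simps)
  next
    case False
    define S where "S = (\<lambda>m::nat. {n. 1 \<le> n \<and> n < k \<and> norm (\<mu> ^ n - 1) < (1 / 2) ^ Suc m})"
    have q_le: "q m \<le> real n" if n: "1 \<le> n" "n < k" and le: "norm (\<mu> ^ n - 1) \<le> 4 * (1 / 2) ^ Suc m" for n m
    proof -
      have "\<gamma> / real n ^ 2 \<le> 4 * (1 / 2) ^ Suc m" using dioph[OF n] le by linarith
      then have "\<gamma> * 2 ^ m / 2 \<le> real n ^ 2"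
        using n by (simp add: field_simps power_divide)
      then show ?thesis unfolding q_def by (intro real_le_lsqrt) auto
    qed
    have gap: "gapped (q m) (S m)" for m
      unfolding gapped_def
    proof (intro conjI ballI impI q0)
      fix s assume "s \<in> S m"
      then have s: "1 \<le> s" "s < k" "norm (\<mu> ^ s - 1) < (1 / 2) ^ Suc m"
        by (auto simp: S_def simp del: power_Suc)
      have "0 < (1 / 2 :: real) ^ Suc m" by simp
      with s(3) have "norm (\<mu> ^ s - 1) \<le> 4 * (1 / 2) ^ Suc m" by linarith
      with s(1,2) show "q m \<le> real s" by (rule q_le)
    next
      fix s t assume *: "s \<in> S m" "t \<in> S m" "s < t"
      have "(1 / 2 :: real) ^ Suc m \<le> 1 / 2" by (simp add: power_le_one)
      then have "norm (\<mu> ^ (t - s) - 1) \<le> 4 * (1 / 2) ^ Suc m"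
        using * by (intro small_divisors_gap) (auto simp: S_def)
      then show "q m \<le> real (t - s)" using * by (intro q_le) (auto simp: S_def)
    qed
    have "0 < \<gamma> / real k ^ 2" using \<gamma> False by simp
    \<comment> \<open>Thresholds below \<open>2\<^sup>-\<^sup>M\<close> are met by no divisor of index less than \<open>k\<close>, so finitely many budgets suffice.\<close>
    then obtain M where M: "(1 / 2) ^ M < \<gamma> / real k ^ 2"
      using real_arch_pow_inv[of _ "1 / 2"] by force
    define P where "P = (\<lambda>n. \<Sum>m<M. divisor_budget (S m) (q m) n)"
    have P0: "0 \<le> P n" for n unfolding P_def by (intro sum_nonneg divisor_budget_nonneg)
    have PL: "P n \<le> real n * L" for n
    proof -
      have "P n \<le> (\<Sum>m<M. real n * (2 / q m))"
        unfolding P_def using divisor_budget_le[OF q0] by (intro sum_mono) (simp add: mult.commute)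
      also have "\<dots> = real n * (\<Sum>m<M. 2 / q m)" by (simp add: sum_distrib_left)
      also have "\<dots> \<le> real n * L"
        unfolding L_def using summ q0 by (intro mult_left_mono sum_le_suminf) (auto simp: less_imp_le)
      finally show ?thesis .
    qed
    define W where "W = (\<lambda>i::nat. 2 powr P (i - 1))"
    have "norm (lin_coeff f \<mu> k) \<le> 2 * W k * (10 * B) ^ (k - 1)"
    proof (rule weighted_majorant_bound[where N = k and d = "\<lambda>i. 1 / (\<mu> ^ (i - 1) - 1)"])
      show "0 < B" using B by simp
      show "1 \<le> W 1" using P0 by (simp add: W_def ge_one_powr_ge_zero)
      show "lin_coeff f \<mu> 1 = 1" by (simp add: lin_coeff.simps)
    next
      fix i j es assume j: "2 \<le> j" "j \<le> i" "i \<le> k" and es: "es \<in> pos_compositions j i"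
      have i: "1 \<le> i - 1" "i - 1 < k" using j by auto
      have sum_es: "sum_list es = i" "length es = j" "\<forall>e\<in>set es. 0 < e"
        using es by (auto simp: pos_compositions_def)
      have "\<gamma> / real k ^ 2 \<le> \<gamma> / real (i - 1) ^ 2"
        using i \<gamma> by (intro divide_left_mono power_mono mult_pos_pos) auto
      then have "(1 / 2) ^ M \<le> norm (\<mu> ^ (i - 1) - 1)" using M dioph[OF i] by linarith
      moreover have "(1 / 2 :: real) ^ Suc M \<le> (1 / 2) ^ M" by simp
      ultimately have "1 / norm (\<mu> ^ (i - 1) - 1)
          \<le> 2 * 2 powr (\<Sum>m<M. of_bool (norm (\<mu> ^ (i - 1) - 1) < (1 / 2) ^ Suc m))"
        by (intro inverse_le_dyadic_count) linarith
      also have "(\<Sum>m<M. of_bool (norm (\<mu> ^ (i - 1) - 1) < (1 / 2) ^ Suc m))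
          = (\<Sum>m<M. of_bool (i - 1 \<in> S m) :: real)"
        using i by (simp add: S_def)
      finally have d: "norm (1 / (\<mu> ^ (i - 1) - 1)) \<le> 2 * 2 powr (\<Sum>m<M. of_bool (i - 1 \<in> S m))"
        by (simp add: norm_divide)
      have "(\<Sum>m<M. of_bool (i - 1 \<in> S m)) + sum_list (map (\<lambda>e. P (e - 1)) es) \<le> P (i - 1)"
        unfolding P_def sum_list_map_sum sum.distrib[symmetric]
      proof (rule sum_mono)
        fix m
        show "of_bool (i - 1 \<in> S m) + sum_list (map (\<lambda>e. divisor_budget (S m) (q m) (e - 1)) es)
          \<le> divisor_budget (S m) (q m) (i - 1)"
          using divisor_budget_step[OF gap, of es m] sum_es j by (simp add: add.commute)
      qed
      then have "2 powr ((\<Sum>m<M. of_bool (i - 1 \<in> S m)) + sum_list (map (\<lambda>e. P (e - 1)) es)) \<le> W i"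
        unfolding W_def by (intro powr_mono) auto
      moreover have "prod_list (map W es) = 2 powr sum_list (map (\<lambda>e. P (e - 1)) es)"
        unfolding W_def by (simp add: prod_list_map_powr)
      ultimately have W: "2 powr (\<Sum>m<M. of_bool (i - 1 \<in> S m)) * prod_list (map W es) \<le> W i"
        by (simp only: powr_add)
      have "norm (1 / (\<mu> ^ (i - 1) - 1)) * prod_list (map W es)
          \<le> 2 * 2 powr (\<Sum>m<M. of_bool (i - 1 \<in> S m)) * prod_list (map W es)"
        using d by (intro mult_right_mono prod_list_nonneg) (auto simp: W_def)
      with W show "norm (1 / (\<mu> ^ (i - 1) - 1)) * prod_list (map W es) \<le> 2 * W i"
        by linarith
    next
      fix i :: nat assume "2 \<le> i"
      then show "lin_coeff f \<mu> i = 1 / (\<mu> ^ (i - 1) - 1) *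
          (\<Sum>j = 2..i. f j * (\<Sum>es\<in>pos_compositions j i. prod_list (map (lin_coeff f \<mu>) es)))"
        by (subst lin_coeff.simps) simp
    qed (use B False in \<open>auto simp: W_def\<close>)
    also have "\<dots> \<le> 2 ^ k * (2 powr L) ^ k * (10 * B) ^ k"
    proof (intro mult_mono)
      show "(2 :: real) \<le> 2 ^ k" using False by (cases k) auto
      have "P (k - 1) \<le> real k * L"
        using PL[of "k - 1"] mult_right_mono[of "real (k - 1)" "real k" L] L0 by linarith
      then have "W k \<le> 2 powr (real k * L)" unfolding W_def by (intro powr_mono) auto
      also have "\<dots> = (2 powr L) ^ k" by (simp add: powr_powr[symmetric] powr_realpow mult.commute)
      finally show "W k \<le> (2 powr L) ^ k" .
      show "(10 * B) ^ (k - 1) \<le> (10 * B) ^ k" using B by (intro power_increasing) auto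
    qed (use B in \<open>auto simp: W_def\<close>)
    also have "\<dots> = A ^ k" by (simp only: A_def power_mult_distrib)
    finally show ?thesis .
  qed
  with A1 show ?thesis by (rule that)
qed

section \<open>Power series whose coefficients extend to shrinking neighbourhoods\<close>

lemma Hinf_norm_le:
  assumes "0 < \<rho>" "\<And>z. norm z < \<rho> \<Longrightarrow> norm (g z) \<le> M"
  shows "Hinf_norm \<rho> g \<le> M"
  unfolding Hinf_norm_def by (rule cSUP_least) (use assms in auto)

lemma conv_radius_ge_of_abs_summable:
  fixes a :: "nat \<Rightarrow> complex"
  assumes "0 < \<rho>" "summable (\<lambda>k. norm (a k) * \<rho> ^ k)"
  shows "ereal \<rho> \<le> fps_conv_radius (Abs_fps a)"
proof -
  have "summable (\<lambda>k. a k * of_real \<rho> ^ k)"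
    using assms by (intro summable_norm_cancel[OF summable_cong[THEN iffD1, OF _ assms(2)]])
      (auto simp: norm_mult norm_power)
  from conv_radius_geI[OF this] show ?thesis
    using assms(1) by (simp add: fps_conv_radius_def)
qed

lemma eval_fps_in_Hinf:
  fixes a :: "nat \<Rightarrow> complex"
  assumes \<rho>: "0 < \<rho>" and summ: "summable (\<lambda>k. norm (a k) * \<rho> ^ k)"
  shows "eval_fps (Abs_fps a) \<in> Hinf \<rho>"
    and "norm z < \<rho> \<Longrightarrow> (\<lambda>k. a k * z ^ k) sums eval_fps (Abs_fps a) z"
proof -
  have rad: "ereal \<rho> \<le> fps_conv_radius (Abs_fps a)"
    by (rule conv_radius_ge_of_abs_summable[OF assms])
  show sums: "(\<lambda>k. a k * z ^ k) sums eval_fps (Abs_fps a) z" if "norm z < \<rho>" for z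
  proof -
    have "ereal (norm z) < fps_conv_radius (Abs_fps a)"
      using that rad by (meson ereal_less_eq(3) less_ereal.simps(1) less_le_trans)
    from sums_eval_fps[OF this] show ?thesis by simp
  qed
  have "norm (eval_fps (Abs_fps a) z) \<le> (\<Sum>k. norm (a k) * \<rho> ^ k)" if "norm z < \<rho>" for z
    unfolding sums_unique[OF sums[OF that]]
    by (rule norm_suminf_le)
       (use summ that in \<open>auto simp: norm_mult norm_power intro!: mult_left_mono power_mono\<close>)
  then have "bounded (eval_fps (Abs_fps a) ` ball 0 \<rho>)"
    by (intro boundedI[where B = "\<Sum>k. norm (a k) * \<rho> ^ k"]) auto
  moreover have "eval_fps (Abs_fps a) holomorphic_on ball 0 \<rho>"
  proof (rule holomorphic_on_eval_fps)
    show "ball (0 :: complex) \<rho> \<subseteq> eball 0 (fps_conv_radius (Abs_fps a))"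
    proof (rule subsetI)
      fix x :: complex assume "x \<in> ball 0 \<rho>"
      then have "ereal (dist 0 x) < ereal \<rho>" by simp
      also note rad
      finally show "x \<in> eball 0 (fps_conv_radius (Abs_fps a))" by (simp add: in_eball_iff)
    qed
  qed
  ultimately show "eval_fps (Abs_fps a) \<in> Hinf \<rho>" by (simp add: Hinf_def)
qed

lemma higher_deriv_bound:
  assumes hol: "g holomorphic_on ball \<mu> d" and bd: "\<And>\<nu>. \<nu> \<in> ball \<mu> d \<Longrightarrow> norm (g \<nu>) \<le> M"
    and d: "0 < d" and \<nu>: "\<nu> \<in> ball \<mu> (d / 2)"
  shows "norm ((deriv ^^ n) g \<nu>) \<le> fact n * M * (4 / d) ^ n"
proof -
  have sub: "cball \<nu> (d / 4) \<subseteq> ball \<mu> d"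
  proof
    fix x assume "x \<in> cball \<nu> (d / 4)"
    then show "x \<in> ball \<mu> d" using \<nu> d dist_triangle[of \<mu> x \<nu>] by simp
  qed
  have "norm ((deriv ^^ n) g \<nu>) \<le> fact n * M / (d / 4) ^ n"
  proof (rule Cauchy_inequality)
    show "g holomorphic_on ball \<nu> (d / 4)"
      using hol sub ball_subset_cball by (meson holomorphic_on_subset subset_trans)
    show "continuous_on (cball \<nu> (d / 4)) g"
      using hol sub by (meson holomorphic_on_imp_continuous_on holomorphic_on_subset)
    show "norm (g x) \<le> M" if "norm (\<nu> - x) = d / 4" for x
      using that sub by (intro bd) (auto simp: dist_norm subset_iff)
  qed (use d in simp)
  then show ?thesis by (simp add: power_divide)
qed

text \<open>The disks of radius \<open>d\<close> around \<open>\<mu>1\<close> and \<open>\<mu>2\<close> may be disjoint. For distances below \<open>d / 2\<close> this is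
  Taylor's formula; otherwise \<open>4 \<bar>\<mu>1 - \<mu>2\<bar> / d\<close> is at least \<open>1\<close>, and each term of the remainder is
  bounded on its own by Cauchy's inequality, after multiplication with suitable powers of that quotient.\<close>

lemma higher_deriv_taylor_bound:
  fixes g :: "complex \<Rightarrow> complex"
  assumes hol: "g holomorphic_on ball \<mu>1 d" "g holomorphic_on ball \<mu>2 d"
    and bd: "\<And>\<nu>. \<nu> \<in> ball \<mu>1 d \<union> ball \<mu>2 d \<Longrightarrow> norm (g \<nu>) \<le> M"
    and d: "0 < d"
  shows "norm ((\<Sum>h = 0..m. (deriv ^^ (n + h)) g \<mu>1 / fact h * (\<mu>2 - \<mu>1) ^ h) - (deriv ^^ n) g \<mu>2)
    \<le> (real m + 2) * fact (n + m + 1) * M * (4 / d) ^ (n + m + 1) * norm (\<mu>1 - \<mu>2) ^ (m + 1)"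
proof -
  have "norm (g \<mu>1) \<le> M" using bd[of \<mu>1] d by simp
  then have M: "0 \<le> M" using norm_ge_zero[of "g \<mu>1"] by linarith
  define \<Delta> where "\<Delta> = norm (\<mu>1 - \<mu>2)"
  have sym: "norm (\<mu>2 - \<mu>1) = \<Delta>" unfolding \<Delta>_def by (rule norm_minus_commute)
  have \<Delta>0: "0 \<le> \<Delta>" by (simp add: \<Delta>_def)
  define K where "K = fact (n + m + 1) * M * (4 / d) ^ (n + m + 1) * \<Delta> ^ (m + 1)"
  have K0: "0 \<le> K" using M d \<Delta>0 by (simp add: K_def)
  let ?R = "(\<Sum>h = 0..m. (deriv ^^ (n + h)) g \<mu>1 / fact h * (\<mu>2 - \<mu>1) ^ h) - (deriv ^^ n) g \<mu>2"
  have "norm ?R \<le> (real m + 2) * K"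
  proof (cases "\<Delta> < d / 2")
    case True
    let ?S = "ball \<mu>1 (d / 2)"
    have "norm ((deriv ^^ (n + 0)) g \<mu>2 - (\<Sum>i\<le>m. (deriv ^^ (n + i)) g \<mu>1 * (\<mu>2 - \<mu>1) ^ i / fact i))
      \<le> (fact (n + Suc m) * M * (4 / d) ^ (n + Suc m)) * norm (\<mu>2 - \<mu>1) ^ Suc m / fact m"
    proof (rule complex_Taylor[where S = ?S and f = "\<lambda>i. (deriv ^^ (n + i)) g"])
      fix i x assume x: "x \<in> ?S"
      have "(deriv ^^ (n + i)) g holomorphic_on ball \<mu>1 d"
        using hol(1) by (rule holomorphic_higher_deriv) simp
      moreover have "x \<in> ball \<mu>1 d" using x d by simp
      ultimately have "((deriv ^^ (n + i)) g has_field_derivative deriv ((deriv ^^ (n + i)) g) x) (at x)"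
        by (intro holomorphic_derivI[of _ "ball \<mu>1 d"]) auto
      then show "((deriv ^^ (n + i)) g has_field_derivative (deriv ^^ (n + Suc i)) g x) (at x within ?S)"
        by (auto intro: has_field_derivative_at_within)
    next
      fix x assume "x \<in> ?S"
      then show "norm ((deriv ^^ (n + Suc m)) g x) \<le> fact (n + Suc m) * M * (4 / d) ^ (n + Suc m)"
        using bd by (intro higher_deriv_bound[OF hol(1) _ d]) auto
    next
      show "\<mu>2 \<in> ?S" using True by (simp add: dist_norm \<Delta>_def)
    qed (use d in auto)
    also have "\<dots> = K / fact m" by (simp add: K_def sym)
    also have "\<dots> \<le> K" using K0 divide_left_mono[of 1 "fact m" K] by simp
    also have "\<dots> \<le> (real m + 2) * K" using K0 mult_right_mono[of 1 "real m + 2" K] by simp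
    finally have "norm ((deriv ^^ n) g \<mu>2 - (\<Sum>i\<le>m. (deriv ^^ (n + i)) g \<mu>1 * (\<mu>2 - \<mu>1) ^ i / fact i))
      \<le> (real m + 2) * K" by simp
    then show ?thesis by (simp add: norm_minus_commute atLeast0AtMost)
  next
    case False
    define t where "t = 4 / d * \<Delta>"
    have t1: "1 \<le> t" using False d by (simp add: t_def field_simps)
    have K_eq: "K = fact (n + m + 1) * M * (4 / d) ^ n * t ^ (m + 1)"
      unfolding K_def t_def power_mult_distrib[of "4 / d" \<Delta>] power_add by (simp only: mult_ac)
    have term_le: "fact (n + h) / fact h * M * (4 / d) ^ n * t ^ h \<le> K" if "h \<le> m" for h
      unfolding K_eq
    proof (intro mult_mono)
      have "(fact (n + h) :: real) / fact h \<le> fact (n + h)"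
        using divide_left_mono[of 1 "fact h" "fact (n + h) :: real"] by simp
      also have "\<dots> \<le> fact (n + m + 1)" using that by (intro fact_mono) simp
      finally show "(fact (n + h) :: real) / fact h \<le> fact (n + m + 1)" .
      show "t ^ h \<le> t ^ (m + 1)" using t1 that by (intro power_increasing) auto
    qed (use M d t1 in auto)
    have "norm ((deriv ^^ (n + h)) g \<mu>1 / fact h * (\<mu>2 - \<mu>1) ^ h) \<le> K" if "h \<le> m" for h
    proof -
      have pow: "(4 / d) ^ (n + h) * \<Delta> ^ h = (4 / d) ^ n * t ^ h"
        by (simp only: t_def power_add power_mult_distrib mult.assoc)
      have "norm ((deriv ^^ (n + h)) g \<mu>1) \<le> fact (n + h) * M * (4 / d) ^ (n + h)"
        using bd d by (intro higher_deriv_bound[OF hol(1) _ d]) auto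
      then have "norm ((deriv ^^ (n + h)) g \<mu>1) / fact h * \<Delta> ^ h
          \<le> fact (n + h) * M * (4 / d) ^ (n + h) / fact h * \<Delta> ^ h"
        using \<Delta>0 by (intro mult_right_mono divide_right_mono) auto
      also have "\<dots> = fact (n + h) / fact h * M * (4 / d) ^ n * t ^ h"
        using pow by (simp add: mult.assoc)
      also have "\<dots> \<le> K" using term_le[OF that] .
      finally show ?thesis by (simp add: norm_mult norm_divide norm_power sym)
    qed
    then have "norm (\<Sum>h = 0..m. (deriv ^^ (n + h)) g \<mu>1 / fact h * (\<mu>2 - \<mu>1) ^ h) \<le> (\<Sum>h = 0..m. K)"
      by (intro sum_norm_le) auto
    then have "norm (\<Sum>h = 0..m. (deriv ^^ (n + h)) g \<mu>1 / fact h * (\<mu>2 - \<mu>1) ^ h) \<le> (real m + 1) * K"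
      by (simp add: add.commute)
    moreover have "norm ((deriv ^^ n) g \<mu>2) \<le> fact n * M * (4 / d) ^ n"
      using bd d by (intro higher_deriv_bound[OF hol(2) _ d]) auto
    moreover have "fact n * M * (4 / d) ^ n \<le> K" using term_le[of 0] by simp
    moreover have "norm ?R \<le> norm (\<Sum>h = 0..m. (deriv ^^ (n + h)) g \<mu>1 / fact h * (\<mu>2 - \<mu>1) ^ h)
        + norm ((deriv ^^ n) g \<mu>2)" by (rule norm_triangle_ineq4)
    ultimately show ?thesis by (simp add: algebra_simps)
  qed
  then show ?thesis by (simp add: K_def \<Delta>_def mult_ac)
qed

text \<open>The remainder of order \<open>m\<close> of the \<open>n\<close>-th derivative of the \<open>k\<close>-th coefficient costs a factor
  \<open>\<delta>\<^sub>k\<close> to the power \<open>- (n + m + 1)\<close>, and the summability hypothesis says that the sum over \<open>k\<close> survives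
  this. The bound gained is of order \<open>\<bar>\<mu>1 - \<mu>2\<bar>\<^sup>m\<^sup>+\<^sup>1\<close>, one more than required, which makes it small
  relative to \<open>\<bar>\<mu>1 - \<mu>2\<bar>\<^sup>m\<close>; for \<open>m = 0\<close> it is Lipschitz continuity.\<close>

lemma Cinf_hol_power_series:
  fixes c :: "nat \<Rightarrow> complex \<Rightarrow> complex" and \<delta> :: "nat \<Rightarrow> real"
  assumes \<rho>: "0 < \<rho>" and \<delta>: "\<And>k. 0 < \<delta> k"
    and summ: "\<And>p. summable (\<lambda>k. (A * \<rho>) ^ k / \<delta> k ^ p)"
    and hol: "\<And>\<mu> k. \<mu> \<in> C \<Longrightarrow> c k holomorphic_on ball \<mu> (\<delta> k)"
    and bd: "\<And>\<mu> \<nu> k. \<mu> \<in> C \<Longrightarrow> \<nu> \<in> ball \<mu> (\<delta> k) \<Longrightarrow> norm (c k \<nu>) \<le> A ^ k"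
  shows "Cinf_hol C (Hinf \<rho>) (Hinf_norm \<rho>) (\<lambda>\<mu>. eval_fps (Abs_fps (\<lambda>k. c k \<mu>)))"
proof -
  define a where "a = (\<lambda>n \<mu> k. (deriv ^^ n) (c k) \<mu>)"
  define D where "D = (\<lambda>n \<mu>. eval_fps (Abs_fps (a n \<mu>)))"
  have summ': "summable (\<lambda>k. Q * A ^ k * (4 / \<delta> k) ^ p * \<rho> ^ k)" for Q p
  proof -
    have "summable (\<lambda>k. Q * 4 ^ p * ((A * \<rho>) ^ k / \<delta> k ^ p))"
      using summ by (rule summable_mult)
    then show ?thesis by (simp add: power_divide power_mult_distrib mult_ac)
  qed
  have a_summ: "summable (\<lambda>k. norm (a n \<mu> k) * \<rho> ^ k)" if "\<mu> \<in> C" for n \<mu>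
  proof (rule summable_comparison_test')
    show "summable (\<lambda>k. fact n * A ^ k * (4 / \<delta> k) ^ n * \<rho> ^ k)" by (rule summ')
    fix k
    have "norm (a n \<mu> k) \<le> fact n * A ^ k * (4 / \<delta> k) ^ n"
      unfolding a_def using hol[OF that] bd[OF that] \<delta>[of k]
      by (intro higher_deriv_bound) auto
    then show "norm (norm (a n \<mu> k) * \<rho> ^ k) \<le> fact n * A ^ k * (4 / \<delta> k) ^ n * \<rho> ^ k"
      using \<rho> by (simp add: mult_right_mono)
  qed
  have rem: "\<exists>Z\<ge>0. \<forall>\<mu>1\<in>C. \<forall>\<mu>2\<in>C. \<forall>z. norm z < \<rho> \<longrightarrow>
      norm (taylor_remainder D n m \<mu>1 \<mu>2 z) \<le> Z * norm (\<mu>1 - \<mu>2) ^ (m + 1)" for n m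
  proof (cases "C = {}")
    case False
    then obtain \<mu>0 where "\<mu>0 \<in> C" by blast
    then have "norm (c 1 \<mu>0) \<le> A ^ 1" using \<delta>[of 1] by (intro bd[of \<mu>0]) auto
    then have A0: "0 \<le> A" by (metis norm_ge_zero order_trans power_one_right)
    define Q where "Q = (real m + 2) * fact (n + m + 1)"
    define b where "b = (\<lambda>k. Q * A ^ k * (4 / \<delta> k) ^ (n + m + 1) * \<rho> ^ k)"
    have b0: "0 \<le> b k" for k using A0 \<rho> \<delta>[of k] by (simp add: b_def Q_def)
    have bs: "summable b" unfolding b_def by (rule summ')
    have "norm (taylor_remainder D n m \<mu>1 \<mu>2 z) \<le> suminf b * norm (\<mu>1 - \<mu>2) ^ (m + 1)"
      if \<mu>: "\<mu>1 \<in> C" "\<mu>2 \<in> C" and z: "norm z < \<rho>" for \<mu>1 \<mu>2 z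
    proof -
      have D: "(\<lambda>k. a i \<mu> k * z ^ k) sums D i \<mu> z" if "\<mu> \<in> C" for i \<mu>
        unfolding D_def using eval_fps_in_Hinf(2)[OF \<rho> a_summ[OF that] z] .
      define r where "r = (\<lambda>k. (\<Sum>h = 0..m. a (n + h) \<mu>1 k / fact h * (\<mu>2 - \<mu>1) ^ h) - a n \<mu>2 k)"
      have "(\<lambda>k. (\<Sum>h = 0..m. a (n + h) \<mu>1 k * z ^ k * ((\<mu>2 - \<mu>1) ^ h / fact h)) - a n \<mu>2 k * z ^ k)
          sums ((\<Sum>h = 0..m. D (n + h) \<mu>1 z * ((\<mu>2 - \<mu>1) ^ h / fact h)) - D n \<mu>2 z)"
        using D \<mu> by (intro sums_diff sums_sum sums_mult2) auto
      also have "(\<lambda>k. (\<Sum>h = 0..m. a (n + h) \<mu>1 k * z ^ k * ((\<mu>2 - \<mu>1) ^ h / fact h)) - a n \<mu>2 k * z ^ k)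
          = (\<lambda>k. r k * z ^ k)"
        by (intro ext) (simp add: r_def sum_distrib_left algebra_simps)
      also have "(\<Sum>h = 0..m. D (n + h) \<mu>1 z * ((\<mu>2 - \<mu>1) ^ h / fact h)) - D n \<mu>2 z
          = taylor_remainder D n m \<mu>1 \<mu>2 z"
        by (simp add: taylor_remainder_def)
      finally have sums: "(\<lambda>k. r k * z ^ k) sums taylor_remainder D n m \<mu>1 \<mu>2 z" .
      have le: "norm (r k * z ^ k) \<le> b k * norm (\<mu>1 - \<mu>2) ^ (m + 1)" for k
      proof -
        have "norm (r k) \<le> (real m + 2) * fact (n + m + 1) * A ^ k * (4 / \<delta> k) ^ (n + m + 1)
            * norm (\<mu>1 - \<mu>2) ^ (m + 1)"
          unfolding r_def a_def using hol \<mu> bd \<delta>[of k]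
          by (intro higher_deriv_taylor_bound) auto
        moreover have "norm (z ^ k) \<le> \<rho> ^ k" using z by (simp add: norm_power power_mono)
        ultimately have "norm (r k) * norm (z ^ k) \<le> ((real m + 2) * fact (n + m + 1) * A ^ k
            * (4 / \<delta> k) ^ (n + m + 1) * norm (\<mu>1 - \<mu>2) ^ (m + 1)) * \<rho> ^ k"
          using norm_ge_zero by (intro mult_mono) (auto intro: order_trans[OF norm_ge_zero])
        then show ?thesis by (simp add: norm_mult b_def Q_def mult_ac)
      qed
      have "norm (taylor_remainder D n m \<mu>1 \<mu>2 z) \<le> (\<Sum>k. b k * norm (\<mu>1 - \<mu>2) ^ (m + 1))"
        unfolding sums_unique[OF sums] using le bs by (intro norm_suminf_le summable_mult2)
      also have "\<dots> = suminf b * norm (\<mu>1 - \<mu>2) ^ (m + 1)"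
        using bs by (rule suminf_mult2[symmetric])
      finally show ?thesis .
    qed
    moreover have "0 \<le> suminf b" using bs b0 by (rule suminf_nonneg)
    ultimately show ?thesis by blast
  qed (auto intro: exI[of _ 0])
  show ?thesis
    unfolding Cinf_hol_def
  proof (intro exI[of _ D] conjI allI ballI impI)
    fix n
    show "continuous_into C (Hinf \<rho>) (Hinf_norm \<rho>) (D n)"
      unfolding continuous_into_def
    proof (intro conjI ballI allI impI)
      fix \<mu> assume "\<mu> \<in> C"
      then show "D n \<mu> \<in> Hinf \<rho>" unfolding D_def by (intro eval_fps_in_Hinf \<rho> a_summ)
    next
      fix \<mu> and \<epsilon> :: real assume \<mu>: "\<mu> \<in> C" and \<epsilon>: "0 < \<epsilon>"
      obtain Z where Z: "0 \<le> Z" "\<And>\<mu>1 \<mu>2 z. \<mu>1 \<in> C \<Longrightarrow> \<mu>2 \<in> C \<Longrightarrow> norm z < \<rho> \<Longrightarrow>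
          norm (taylor_remainder D n 0 \<mu>1 \<mu>2 z) \<le> Z * norm (\<mu>1 - \<mu>2) ^ (0 + 1)"
        using rem[of n 0] by blast
      show "\<exists>\<delta>>0. \<forall>\<nu>\<in>C. norm (\<nu> - \<mu>) < \<delta> \<longrightarrow> Hinf_norm \<rho> (\<lambda>z. D n \<nu> z - D n \<mu> z) < \<epsilon>"
      proof (intro exI[of _ "\<epsilon> / (Z + 1)"] conjI ballI impI)
        show "0 < \<epsilon> / (Z + 1)" using \<epsilon> Z by simp
        fix \<nu> assume \<nu>: "\<nu> \<in> C" "norm (\<nu> - \<mu>) < \<epsilon> / (Z + 1)"
        have "Hinf_norm \<rho> (\<lambda>z. D n \<nu> z - D n \<mu> z) \<le> Z * norm (\<nu> - \<mu>)"
          using Z(2)[OF \<nu>(1) \<mu>] by (intro Hinf_norm_le \<rho>) (simp add: taylor_remainder_def)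
        also have "\<dots> \<le> (Z + 1) * norm (\<nu> - \<mu>)" by (intro mult_right_mono) auto
        also have "\<dots> < \<epsilon>" using \<nu>(2) Z(1) by (simp add: pos_less_divide_eq mult.commute)
        finally show "Hinf_norm \<rho> (\<lambda>z. D n \<nu> z - D n \<mu> z) < \<epsilon>" .
      qed
    qed
  next
    fix \<mu> assume "\<mu> \<in> C"
    show "D 0 \<mu> = eval_fps (Abs_fps (\<lambda>k. c k \<mu>))" by (simp add: D_def a_def)
  next
    fix n m and \<mu> :: complex and \<epsilon> :: real assume \<mu>: "\<mu> \<in> C" and \<epsilon>: "0 < \<epsilon>"
    obtain Z where Z: "0 \<le> Z" "\<And>\<mu>1 \<mu>2 z. \<mu>1 \<in> C \<Longrightarrow> \<mu>2 \<in> C \<Longrightarrow> norm z < \<rho> \<Longrightarrow>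
        norm (taylor_remainder D n m \<mu>1 \<mu>2 z) \<le> Z * norm (\<mu>1 - \<mu>2) ^ (m + 1)"
      using rem[of n m] by blast
    show "\<exists>\<delta>>0. \<forall>\<mu>1\<in>C. \<forall>\<mu>2\<in>C. norm (\<mu>1 - \<mu>) < \<delta> \<longrightarrow> norm (\<mu>2 - \<mu>) < \<delta> \<longrightarrow>
        Hinf_norm \<rho> (taylor_remainder D n m \<mu>1 \<mu>2) \<le> \<epsilon> * norm (\<mu>1 - \<mu>2) ^ m"
    proof (intro exI[of _ "\<epsilon> / (2 * (Z + 1))"] conjI ballI impI)
      show "0 < \<epsilon> / (2 * (Z + 1))" using \<epsilon> Z by simp
      fix \<mu>1 \<mu>2
      assume C: "\<mu>1 \<in> C" "\<mu>2 \<in> C"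
        and near: "norm (\<mu>1 - \<mu>) < \<epsilon> / (2 * (Z + 1))" "norm (\<mu>2 - \<mu>) < \<epsilon> / (2 * (Z + 1))"
      have "norm (\<mu>1 - \<mu>2) \<le> norm (\<mu>1 - \<mu>) + norm (\<mu>2 - \<mu>)"
        using norm_triangle_ineq4[of "\<mu>1 - \<mu>" "\<mu>2 - \<mu>"] by simp
      also have "\<dots> \<le> \<epsilon> / (2 * (Z + 1)) + \<epsilon> / (2 * (Z + 1))" using near by linarith
      also have "\<dots> = \<epsilon> / (Z + 1)" using Z(1) by (simp add: divide_simps)
      finally have "Z * norm (\<mu>1 - \<mu>2) \<le> (Z + 1) * (\<epsilon> / (Z + 1))"
        using Z(1) by (intro mult_mono) auto
      then have "Z * norm (\<mu>1 - \<mu>2) \<le> \<epsilon>" using Z(1) by simp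
      then have "Z * norm (\<mu>1 - \<mu>2) * norm (\<mu>1 - \<mu>2) ^ m \<le> \<epsilon> * norm (\<mu>1 - \<mu>2) ^ m"
        by (intro mult_right_mono) auto
      then show "Hinf_norm \<rho> (taylor_remainder D n m \<mu>1 \<mu>2) \<le> \<epsilon> * norm (\<mu>1 - \<mu>2) ^ m"
        using Z(2)[OF C] by (intro Hinf_norm_le \<rho>) (force simp: mult_ac)
    qed
  qed
qed

lemma Cinf_hol_imp_C1_hol:
  assumes "Cinf_hol C B (Hinf_norm \<rho>) u"
  shows "C1_hol C B (Hinf_norm \<rho>) u"
proof -
  from assms obtain D where cont: "\<And>n. continuous_into C B (Hinf_norm \<rho>) (D n)"
    and D0: "\<And>\<mu>. \<mu> \<in> C \<Longrightarrow> D 0 \<mu> = u \<mu>"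
    and rem: "\<And>n m \<mu> \<epsilon>. \<mu> \<in> C \<Longrightarrow> 0 < \<epsilon> \<Longrightarrow> \<exists>\<delta>>0. \<forall>\<mu>1\<in>C. \<forall>\<mu>2\<in>C.
      norm (\<mu>1 - \<mu>) < \<delta> \<longrightarrow> norm (\<mu>2 - \<mu>) < \<delta> \<longrightarrow>
      Hinf_norm \<rho> (taylor_remainder D n m \<mu>1 \<mu>2) \<le> \<epsilon> * norm (\<mu>1 - \<mu>2) ^ m"
    unfolding Cinf_hol_def by blast
  have "continuous_into C B (Hinf_norm \<rho>) u"
    using cont[of 0] D0 unfolding continuous_into_def by simp
  moreover have "Hinf_norm \<rho> (\<lambda>z. u \<mu>2 z - u \<mu>1 z - D 1 \<mu>1 z * (\<mu>2 - \<mu>1))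
      = Hinf_norm \<rho> (taylor_remainder D 0 1 \<mu>1 \<mu>2)" if "\<mu>1 \<in> C" "\<mu>2 \<in> C" for \<mu>1 \<mu>2
  proof -
    have "norm (u \<mu>2 z - u \<mu>1 z - D 1 \<mu>1 z * (\<mu>2 - \<mu>1)) = norm (taylor_remainder D 0 1 \<mu>1 \<mu>2 z)" for z
      using D0 that
      by (subst norm_minus_cancel[symmetric]) (simp add: taylor_remainder_def algebra_simps)
    then show ?thesis unfolding Hinf_norm_def by simp
  qed
  ultimately show ?thesis
    unfolding C1_hol_def using cont[of 1] rem[of _ _ 0 1]
    by (intro conjI exI[of _ "D 1"]) auto
qed

lemma summable_power_times_polynomial: "summable (\<lambda>k. (1 / 2 :: real) ^ k * real (k + 1) ^ p)"
proof (rule summable_comparison_test_bigo)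
  show "summable (\<lambda>k. norm ((3 / 4 :: real) ^ k))" by (simp add: summable_geometric)
  show "(\<lambda>k. (1 / 2) ^ k * real (k + 1) ^ p) \<in> O(\<lambda>k. (3 / 4) ^ k)" by real_asymp
qed

section \<open>Almost every rotation is Diophantine\<close>

definition diophantine :: "real \<Rightarrow> complex \<Rightarrow> bool" where
  "diophantine \<gamma> \<mu> \<longleftrightarrow> (\<forall>n\<ge>1. \<gamma> / real n ^ 2 \<le> norm (\<mu> ^ n - 1))"

lemma norm_cis_minus_1: "norm (cis y - 1) = 2 * \<bar>sin (y / 2)\<bar>"
proof -
  have "(norm (cis y - 1))\<^sup>2 = (cos y - 1)\<^sup>2 + (sin y)\<^sup>2" by (simp add: cmod_power2)
  also have "\<dots> = 2 - 2 * cos y"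
    using sin_cos_squared_add[of y] by (simp add: power2_eq_square algebra_simps)
  also have "\<dots> = (2 * \<bar>sin (y / 2)\<bar>)\<^sup>2"
    using cos_double_sin[of "y / 2"] by (simp add: power_mult_distrib)
  finally show ?thesis by (rule power2_eq_imp_eq) auto
qed

text \<open>Up to \<open>pi / 3\<close> the derivative of \<open>sin\<close> is at least \<open>1 / 2\<close>; beyond, \<open>sin\<close> exceeds \<open>17 / 20\<close>.\<close>

lemma half_le_sin:
  assumes "0 \<le> t" "t \<le> pi / 2" shows "t / 2 \<le> sin t"
proof (cases "t \<le> pi / 3")
  case True
  have "sin 0 - 0 / 2 \<le> sin t - t / 2"
  proof (rule DERIV_nonneg_imp_nondecreasing[OF assms(1)])
    fix x assume x: "0 \<le> x" "x \<le> t"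
    have "cos (pi / 3) \<le> cos x" using x True by (intro cos_monotone_0_pi_le) auto
    then have "0 \<le> cos x - 1 / 2" by (simp add: cos_60)
    moreover have "((\<lambda>x. sin x - x / 2) has_real_derivative cos x - 1 / 2) (at x)"
      by (auto intro!: derivative_eq_intros)
    ultimately show "\<exists>y. ((\<lambda>x. sin x - x / 2) has_real_derivative y) (at x) \<and> 0 \<le> y" by blast
  qed
  then show ?thesis by simp
next
  case False
  have "sin (pi / 3) \<le> sin t"
    using False assms by (intro sin_monotone_2pi_le) auto
  moreover have "(17 / 10 :: real) \<le> sqrt 3" by (rule real_le_rsqrt) (simp add: power2_eq_square)
  ultimately show ?thesis using assms pi_less_4 sin_60 pi_approx by simp
qed

lemma abs_le_norm_cis_minus_1:
  assumes "\<bar>y\<bar> \<le> pi" shows "\<bar>y\<bar> \<le> 2 * norm (cis y - 1)"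
proof -
  have "\<bar>y\<bar> / 2 / 2 \<le> sin (\<bar>y\<bar> / 2)" using assms by (intro half_le_sin) auto
  also have "\<dots> \<le> \<bar>sin (y / 2)\<bar>" by (cases "0 \<le> y") (auto simp: abs_if)
  finally show ?thesis by (simp add: norm_cis_minus_1)
qed

text \<open>The angle \<open>n \<theta>\<close> is within \<open>2 c\<close> of a multiple of \<open>2 pi\<close>, because a chord is at least half as long as its arc.\<close>

lemma angle_near_resonance:
  assumes n: "1 \<le> n" and \<theta>: "0 \<le> \<theta>" "\<theta> < 2 * pi" and c: "norm (cis \<theta> ^ n - 1) < c"
  shows "\<exists>p\<le>n. \<bar>\<theta> - 2 * pi * real p / real n\<bar> \<le> 2 * c / real n"
proof -
  define x where "x = real n * \<theta>"
  define i where "i = \<lfloor>(x + pi) / (2 * pi)\<rfloor>"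
  have x0: "0 \<le> x" "x < 2 * pi * real n"
    using \<theta> n by (auto simp: x_def mult.commute)
  have i1: "of_int i \<le> (x + pi) / (2 * pi)" "(x + pi) / (2 * pi) < of_int i + 1"
    unfolding i_def by linarith+
  then have y: "\<bar>x - 2 * pi * of_int i\<bar> \<le> pi" using pi_gt_zero by (auto simp: field_simps abs_le_iff)
  have "0 \<le> i" using x0 unfolding i_def by simp
  then obtain p where p: "i = int p" using zero_le_imp_eq_int by blast
  have "real p * (2 * pi) \<le> x + pi" using i1(1) p by (simp add: field_simps)
  also have "\<dots> < (real n + 1 / 2) * (2 * pi)" using x0 by (simp add: algebra_simps)
  finally have "real p < real n + 1 / 2" by simp
  then have "p \<le> n" by linarith
  have "cis (x - 2 * pi * of_int i) = cis x / cis (2 * pi * of_int i)" by (simp only: cis_divide)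
  also have "cis (2 * pi * of_int i) = 1" by (rule cis_multiple_2pi) simp
  finally have "cis (x - 2 * pi * of_int i) = cis \<theta> ^ n" by (simp add: x_def Complex.DeMoivre)
  then have "\<bar>x - 2 * pi * real p\<bar> \<le> 2 * c"
    using abs_le_norm_cis_minus_1[OF y] c p by simp
  moreover have "\<theta> - 2 * pi * real p / real n = (x - 2 * pi * real p) / real n"
    using n by (simp add: x_def field_simps)
  ultimately have "\<bar>\<theta> - 2 * pi * real p / real n\<bar> \<le> 2 * c / real n"
    using n by (simp add: abs_divide divide_right_mono)
  with \<open>p \<le> n\<close> show ?thesis by blast
qed

lemma closed_diophantine: "closed {\<mu>. diophantine \<gamma> \<mu>}"
  unfolding diophantine_def by (intro closed_Collect_all closed_Collect_imp closed_Collect_le) (auto intro!: continuous_intros)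

lemma summable_inverse_Suc_squares: "summable (\<lambda>n. 1 / real (Suc n) ^ 2)"
proof -
  have "summable (\<lambda>n. inverse (real n ^ 2))" by (rule inverse_power_summable) simp
  then show ?thesis
    using summable_Suc_iff[of "\<lambda>n. inverse (real n ^ 2)"] by (simp add: inverse_eq_divide)
qed

text \<open>For each \<open>n\<close> the excluded angles lie in \<open>n + 1 \<le> 2 n\<close> intervals of length \<open>4 \<gamma> / n\<^sup>3\<close>; the total length
  \<open>8 \<gamma> \<Sum>\<^sub>n 1 / n\<^sup>2\<close> is small with \<open>\<gamma>\<close>.\<close>

lemma arc_length_diophantine:
  assumes "0 < \<epsilon>"
  obtains \<gamma> where "0 < \<gamma>" "\<gamma> \<le> 1"
    "ennreal (2 * pi - \<epsilon>) \<le> emeasure arc_length {z \<in> sphere 0 1. diophantine \<gamma> z}"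
proof -
  define L where "L = (\<Sum>n. 1 / real (Suc n) ^ 2)"
  have L0: "0 \<le> L" unfolding L_def by (rule suminf_nonneg[OF summable_inverse_Suc_squares]) simp
  define \<gamma> where "\<gamma> = min 1 (\<epsilon> / (8 * (L + 1)))"
  have \<gamma>: "0 < \<gamma>" "\<gamma> \<le> 1" using assms L0 by (auto simp: \<gamma>_def)
  have "\<gamma> * L \<le> \<gamma> * (L + 1)" using \<gamma> by simp
  also have "\<gamma> * (L + 1) \<le> \<epsilon> / (8 * (L + 1)) * (L + 1)"
    using L0 by (intro mult_right_mono) (auto simp: \<gamma>_def)
  also have "\<epsilon> / (8 * (L + 1)) * (L + 1) = \<epsilon> / 8" using L0 by (simp add: divide_simps)
  finally have \<gamma>L: "8 * \<gamma> * L \<le> \<epsilon>" by simp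
  define J where "J = (\<lambda>n p. cbox (2 * pi * real p / real (Suc n) - 2 * \<gamma> / real (Suc n) ^ 3)
    (2 * pi * real p / real (Suc n) + 2 * \<gamma> / real (Suc n) ^ 3))"
  define U where "U = (\<lambda>n. \<Union>p\<le>Suc n. J n p)"
  have U_sets: "U n \<in> sets lborel" for n unfolding U_def J_def by auto
  have U_le: "emeasure lborel (U n) \<le> ennreal (8 * \<gamma> * (1 / real (Suc n) ^ 2))" for n
  proof -
    have "emeasure lborel (U n) \<le> (\<Sum>p\<le>Suc n. emeasure lborel (J n p))"
      unfolding U_def by (rule emeasure_subadditive_finite) (auto simp: J_def)
    also have "\<dots> = (\<Sum>p\<le>Suc n. ennreal (4 * \<gamma> / real (Suc n) ^ 3))"
      unfolding J_def using \<gamma> by (intro sum.cong) (auto simp: emeasure_lborel_cbox_eq)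
    also have "\<dots> = ennreal (\<Sum>p\<le>Suc n. 4 * \<gamma> / real (Suc n) ^ 3)"
      using \<gamma> by (intro sum_ennreal) auto
    also have "(\<Sum>p\<le>Suc n. 4 * \<gamma> / real (Suc n) ^ 3) = (real (Suc n) + 1) * (4 * \<gamma> / real (Suc n) ^ 3)"
      by (simp add: add.commute)
    also have "\<dots> \<le> (2 * real (Suc n)) * (4 * \<gamma> / real (Suc n) ^ 3)"
      using \<gamma> by (intro mult_right_mono) auto
    also have "\<dots> = 8 * \<gamma> * (1 / real (Suc n) ^ 2)"
      by (simp add: power3_eq_cube power2_eq_square del: of_nat_Suc)
    finally show ?thesis by (simp add: ennreal_leI)
  qed
  have "emeasure lborel (\<Union>n. U n) \<le> (\<Sum>n. emeasure lborel (U n))"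
    using U_sets by (intro emeasure_subadditive_countably) auto
  also have "\<dots> \<le> (\<Sum>n. ennreal (8 * \<gamma> * (1 / real (Suc n) ^ 2)))"
    by (intro suminf_le U_le) auto
  also have "\<dots> = ennreal (\<Sum>n. 8 * \<gamma> * (1 / real (Suc n) ^ 2))"
    using \<gamma> by (intro suminf_ennreal2 summable_mult summable_inverse_Suc_squares) auto
  also have "(\<Sum>n. 8 * \<gamma> * (1 / real (Suc n) ^ 2)) = 8 * \<gamma> * L"
    unfolding L_def by (rule suminf_mult[OF summable_inverse_Suc_squares])
  finally have bad: "emeasure lborel (\<Union>n. U n) \<le> ennreal \<epsilon>"
    using \<gamma>L by (meson ennreal_leI order_trans)
  define E where "E = {z \<in> sphere 0 1. diophantine \<gamma> z}"
  have "closed E"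
    unfolding E_def using closed_Int[OF closed_sphere[of 0 1] closed_diophantine[of \<gamma>]]
    by (simp add: Int_def dist_norm)
  then have E_sets: "E \<in> sets borel" by simp
  have cis_meas: "cis \<in> measurable (restrict_space lborel {0..<2 * pi}) borel"
    by (intro measurable_restrict_space1) (simp add: borel_measurable_continuous_onI continuous_on_cis continuous_on_id)
  define G where "G = cis -` E \<inter> {0..<2 * pi}"
  have cis_borel: "cis \<in> borel_measurable borel"
    by (intro borel_measurable_continuous_onI continuous_on_cis continuous_on_id)
  have G_sets: "G \<in> sets lborel"
    using measurable_sets[OF cis_borel E_sets] by (auto simp: G_def)
  have "emeasure arc_length E = emeasure (restrict_space lborel {0..<2 * pi}) G"
    unfolding arc_length_def G_def using emeasure_distr[OF cis_meas E_sets]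
    by (simp add: space_restrict_space)
  also have "\<dots> = emeasure lborel G"
    by (rule emeasure_restrict_space) (auto simp: G_def)
  finally have E_eq: "emeasure arc_length E = emeasure lborel G" .
  have cover: "{0..<2 * pi} \<subseteq> G \<union> (\<Union>n. U n)"
  proof
    fix \<theta> :: real assume \<theta>: "\<theta> \<in> {0..<2 * pi}"
    show "\<theta> \<in> G \<union> (\<Union>n. U n)"
    proof (cases "diophantine \<gamma> (cis \<theta>)")
      case True
      then show ?thesis using \<theta> by (simp add: G_def E_def)
    next
      case False
      then obtain n where n: "1 \<le> n" "norm (cis \<theta> ^ n - 1) < \<gamma> / real n ^ 2"
        by (auto simp: diophantine_def not_le)
      then obtain k where k: "n = Suc k" by (cases n) auto
      obtain p where p: "p \<le> n" "\<bar>\<theta> - 2 * pi * real p / real n\<bar> \<le> 2 * (\<gamma> / real n ^ 2) / real n"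
        using angle_near_resonance[OF n(1) _ _ n(2)] \<theta> by auto
      have eq: "2 * (\<gamma> / real n ^ 2) / real n = 2 * \<gamma> / real n ^ 3"
        by (simp add: power2_eq_square power3_eq_cube)
      have "\<bar>\<theta> - 2 * pi * real p / real (Suc k)\<bar> \<le> 2 * \<gamma> / real (Suc k) ^ 3"
        using p(2) unfolding eq unfolding k .
      then have "\<theta> \<in> J k p" by (auto simp: J_def abs_le_iff simp del: of_nat_Suc)
      then show ?thesis using p(1) k by (auto simp: U_def)
    qed
  qed
  have "ennreal (2 * pi) = emeasure lborel {0..<2 * pi}" by simp
  also have "\<dots> \<le> emeasure lborel (G \<union> (\<Union>n. U n))"
    using cover G_sets U_sets by (intro emeasure_mono) auto
  also have "\<dots> \<le> emeasure lborel G + emeasure lborel (\<Union>n. U n)"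
    using G_sets U_sets by (intro emeasure_subadditive) auto
  also have "\<dots> \<le> emeasure lborel G + ennreal \<epsilon>" using bad by (rule add_left_mono)
  finally have "ennreal (2 * pi) - ennreal \<epsilon> \<le> emeasure lborel G"
    by (simp add: ennreal_minus_le_iff add.commute)
  then have "ennreal (2 * pi - \<epsilon>) \<le> emeasure arc_length E"
    using assms by (simp add: E_eq ennreal_minus)
  with \<gamma> show ?thesis using that E_def by blast
qed

lemma annulus_area:
  assumes "0 < \<eta>" "\<eta> < 1"
  shows "emeasure lborel {z :: complex. 1 - \<eta> < norm z \<and> norm z < 1 + \<eta>} \<le> ennreal (4 * pi * \<eta>)"
proof -
  have "{z :: complex. 1 - \<eta> < norm z \<and> norm z < 1 + \<eta>} = ball 0 (1 + \<eta>) - cball 0 (1 - \<eta>)"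
    by auto
  also have "emeasure lborel \<dots> = emeasure lborel (ball (0 :: complex) (1 + \<eta>)) - emeasure lborel (cball (0 :: complex) (1 - \<eta>))"
    using assms by (intro emeasure_Diff) (auto simp: emeasure_cball)
  also have "\<dots> = ennreal (pi * (1 + \<eta>) ^ 2) - ennreal (pi * (1 - \<eta>) ^ 2)"
    using assms by (simp add: emeasure_ball emeasure_cball unit_ball_vol_2)
  also have "\<dots> = ennreal (pi * (1 + \<eta>) ^ 2 - pi * (1 - \<eta>) ^ 2)"
    by (intro ennreal_minus) simp
  also have "pi * (1 + \<eta>) ^ 2 - pi * (1 - \<eta>) ^ 2 = 4 * pi * \<eta>"
    by (simp add: power2_eq_square algebra_simps)
  finally show ?thesis by simp
qed

section \<open>Non-resonant multipliers\<close>

text \<open>The third alternative is the condition \<open>\<bar>\<zeta>\<^sup>n - 1\<bar> \<ge> \<gamma> / n\<^sup>2\<close> on \<open>\<zeta> = \<mu> / \<bar>\<mu>\<bar>\<close>, multiplied by \<open>\<bar>\<mu>\<bar>\<^sup>n\<close> so that it is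
  a closed condition at \<open>\<mu> = 0\<close> too.\<close>

definition nonresonant :: "real \<Rightarrow> real \<Rightarrow> complex set" where
  "nonresonant \<gamma> \<eta> = {\<mu>. norm \<mu> \<le> 1 - \<eta> \<or> 1 + \<eta> \<le> norm \<mu> \<or>
     (\<forall>n\<ge>1. \<gamma> / real n ^ 2 * norm \<mu> ^ n \<le> norm (\<mu> ^ n - of_real (norm \<mu>) ^ n))}"

lemma closed_nonresonant: "closed (nonresonant \<gamma> \<eta>)"
proof -
  have "nonresonant \<gamma> \<eta> = cball 0 (1 - \<eta>) \<union> - ball 0 (1 + \<eta>) \<union>
      (\<Inter>n\<in>{1..}. {\<mu>. \<gamma> / real n ^ 2 * norm \<mu> ^ n \<le> norm (\<mu> ^ n - of_real (norm \<mu>) ^ n)})"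
    by (auto simp: nonresonant_def)
  moreover have "closed {\<mu> :: complex. \<gamma> / real n ^ 2 * norm \<mu> ^ n \<le> norm (\<mu> ^ n - of_real (norm \<mu>) ^ n)}" for n
    by (intro closed_Collect_le continuous_intros)
  ultimately show ?thesis by (simp add: closed_Un closed_INT closed_Compl)
qed

lemma nonresonant_scale:
  assumes \<mu>: "\<forall>n\<ge>1. \<gamma> / real n ^ 2 * norm \<mu> ^ n \<le> norm (\<mu> ^ n - of_real (norm \<mu>) ^ n)" and t: "0 \<le> t"
  shows "of_real t * \<mu> \<in> nonresonant \<gamma> \<eta>"
proof -
  have "\<gamma> / real n ^ 2 * norm (of_real t * \<mu>) ^ n
      \<le> norm ((of_real t * \<mu>) ^ n - of_real (norm (of_real t * \<mu>)) ^ n)" if "1 \<le> n" for n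
  proof -
    have "(of_real t * \<mu>) ^ n - of_real (norm (of_real t * \<mu>)) ^ n
        = of_real (t ^ n) * (\<mu> ^ n - of_real (norm \<mu>) ^ n)"
      using t by (simp add: norm_mult power_mult_distrib algebra_simps)
    then have "norm ((of_real t * \<mu>) ^ n - of_real (norm (of_real t * \<mu>)) ^ n)
        = t ^ n * norm (\<mu> ^ n - of_real (norm \<mu>) ^ n)"
      using t by (simp add: norm_mult norm_power)
    moreover have "t ^ n * (\<gamma> / real n ^ 2 * norm \<mu> ^ n) \<le> t ^ n * norm (\<mu> ^ n - of_real (norm \<mu>) ^ n)"
      using \<mu> t that by (intro mult_left_mono) auto
    ultimately show ?thesis using t by (simp add: norm_mult power_mult_distrib mult_ac)
  qed
  then show ?thesis by (simp add: nonresonant_def)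
qed

lemma nonresonant_ray:
  assumes "diophantine \<gamma> \<mu>" "norm \<mu> = 1" "0 \<le> t"
  shows "of_real t * \<mu> \<in> nonresonant \<gamma> \<eta>"
  using assms by (intro nonresonant_scale) (auto simp: diophantine_def)

text \<open>The inner disk and the rays form a set that is star-shaped around \<open>0\<close>; a single Diophantine ray
  ties the outer region to \<open>0\<close>.\<close>

lemma connected_nonresonant:
  assumes \<zeta>: "diophantine \<gamma> \<zeta>" "norm \<zeta> = 1" and \<eta>: "0 < \<eta>" "\<eta> < 1"
  shows "connected (nonresonant \<gamma> \<eta>)"
proof -
  let ?R = "nonresonant \<gamma> \<eta>"
  have seg: "connected_component ?R \<mu> 0" if seg: "\<And>t. 0 \<le> t \<Longrightarrow> t \<le> 1 \<Longrightarrow> of_real t * \<mu> \<in> ?R" for \<mu>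
  proof -
    have "closed_segment 0 \<mu> \<subseteq> ?R"
      using seg by (auto simp: in_segment scaleR_conv_of_real)
    then show ?thesis unfolding connected_component_def
      by (intro exI[of _ "closed_segment 0 \<mu>"]) auto
  qed
  have "connected_component ?R \<mu> 0" if \<mu>: "\<mu> \<in> ?R" for \<mu>
  proof -
    consider "norm \<mu> \<le> 1 - \<eta>" | "1 + \<eta> \<le> norm \<mu>"
      | "\<forall>n\<ge>1. \<gamma> / real n ^ 2 * norm \<mu> ^ n \<le> norm (\<mu> ^ n - of_real (norm \<mu>) ^ n)"
      using \<mu> unfolding nonresonant_def by blast
    then show ?thesis
    proof cases
      case 1
      have "norm (of_real t * \<mu>) \<le> 1 - \<eta>" if "0 \<le> t" "t \<le> 1" for t
        using mult_mono[of t 1 "norm \<mu>" "1 - \<eta>"] that 1 \<eta> by (simp add: norm_mult)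
      then show ?thesis by (intro seg) (simp add: nonresonant_def)
    next
      case 2
      let ?\<zeta> = "of_real (1 + \<eta>) * \<zeta>"
      have "connected (- ball (0 :: complex) (1 + \<eta>))"
        by (intro connected_complement_bounded_convex) auto
      moreover have "- ball 0 (1 + \<eta>) \<subseteq> ?R" by (auto simp: nonresonant_def)
      moreover have "norm ?\<zeta> = 1 + \<eta>"
        using \<zeta>(2) \<eta> unfolding norm_mult norm_of_real by simp
      then have "?\<zeta> \<in> - ball 0 (1 + \<eta>)" by (simp del: of_real_add)
      moreover have "\<mu> \<in> - ball 0 (1 + \<eta>)" using 2 by simp
      ultimately have "connected_component ?R \<mu> ?\<zeta>" unfolding connected_component_def by blast
      moreover have "connected_component ?R ?\<zeta> 0"
      proof (rule seg)
        fix t :: real assume "0 \<le> t"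
        then show "of_real t * ?\<zeta> \<in> ?R"
          using nonresonant_ray[OF \<zeta>, of "t * (1 + \<eta>)"] \<eta> by (simp add: mult.assoc)
      qed
      ultimately show ?thesis by (rule connected_component_trans)
    next
      case 3
      then show ?thesis by (intro seg nonresonant_scale)
    qed
  qed
  then show ?thesis
    unfolding connected_iff_connected_component
    by (meson connected_component_sym connected_component_trans)
qed

text \<open>The distance from \<open>1\<close> to the real line spanned by \<open>w\<close> is \<open>\<bar>Im w\<bar> / \<bar>w\<bar>\<close>, and \<open>w\<^sup>2 - \<bar>w\<bar>\<^sup>2\<close>
  has modulus \<open>2 \<bar>w\<bar> \<bar>Im w\<bar>\<close>. Doubling the angle in the hypothesis identifies \<open>w\<close> with \<open>- w\<close>, as a distance to a line must.\<close>

lemma norm_minus_1_ge_ray: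
  fixes w :: complex
  assumes "c * norm w ^ 2 \<le> norm (w ^ 2 - of_real (norm w) ^ 2)" and c: "c \<le> 2"
  shows "c / 2 \<le> norm (w - 1)"
proof (cases "w = 0")
  case False
  have "of_real (norm w) ^ 2 = w * cnj w" by (metis complex_norm_square of_real_power)
  then have "w ^ 2 - of_real (norm w) ^ 2 = w * (w - cnj w)"
    by (simp add: power2_eq_square right_diff_distrib)
  then have eq: "norm (w ^ 2 - of_real (norm w) ^ 2) = norm w * (2 * \<bar>Im w\<bar>)"
    by (simp add: norm_mult complex_diff_cnj)
  have "\<bar>Im w\<bar> = \<bar>Im ((w - 1) * cnj w)\<bar>" by (simp add: algebra_simps)
  also have "\<dots> \<le> norm ((w - 1) * cnj w)" by (rule abs_Im_le_cmod)
  finally have "\<bar>Im w\<bar> \<le> norm (w - 1) * norm w" by (simp add: norm_mult)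
  then have "norm w * (2 * \<bar>Im w\<bar>) \<le> norm w * (2 * (norm (w - 1) * norm w))"
    by (intro mult_left_mono) auto
  with assms eq have "c * norm w ^ 2 \<le> 2 * norm (w - 1) * norm w ^ 2"
    by (simp add: power2_eq_square mult_ac)
  then show ?thesis using False by simp
qed (use c in simp)

lemma nonresonant_imp_diophantine:
  assumes \<mu>: "\<mu> \<in> nonresonant \<gamma> \<eta>" and \<gamma>: "0 < \<gamma>" "\<gamma> \<le> 1" and \<eta>: "0 < \<eta>" "\<eta> < 1"
  shows "diophantine (min \<eta> (\<gamma> / 8)) \<mu>"
  unfolding diophantine_def
proof (intro allI impI)
  fix n :: nat assume n: "1 \<le> n"
  have n2: "1 \<le> real n ^ 2" using n by (simp add: one_le_power)
  have "x / real n ^ 2 \<le> x" if "0 \<le> x" for x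
    using mult_left_mono[OF n2 that] n by (simp add: divide_le_eq)
  from this[of \<eta>] have "\<eta> / real n ^ 2 \<le> \<eta>" using \<eta> by simp
  moreover have "min \<eta> (\<gamma> / 8) / real n ^ 2 \<le> \<eta> / real n ^ 2"
    by (intro divide_right_mono) auto
  ultimately have \<eta>n: "min \<eta> (\<gamma> / 8) / real n ^ 2 \<le> \<eta>" by linarith
  consider "norm \<mu> \<le> 1 - \<eta>" | "1 + \<eta> \<le> norm \<mu>"
    | "\<forall>n\<ge>1. \<gamma> / real n ^ 2 * norm \<mu> ^ n \<le> norm (\<mu> ^ n - of_real (norm \<mu>) ^ n)"
    using \<mu> unfolding nonresonant_def by blast
  then show "min \<eta> (\<gamma> / 8) / real n ^ 2 \<le> norm (\<mu> ^ n - 1)"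
  proof cases
    case 1
    have "norm \<mu> ^ n \<le> norm \<mu> ^ 1" using n 1 \<eta> by (intro power_decreasing) auto
    moreover have "1 - norm (\<mu> ^ n) \<le> norm (\<mu> ^ n - 1)"
      using norm_triangle_ineq2[of 1 "\<mu> ^ n"] by (simp add: norm_minus_commute)
    ultimately show ?thesis using 1 \<eta>n by (simp add: norm_power)
  next
    case 2
    have "norm \<mu> ^ 1 \<le> norm \<mu> ^ n" using n 2 \<eta> by (intro power_increasing) auto
    moreover have "norm (\<mu> ^ n) - 1 \<le> norm (\<mu> ^ n - 1)"
      using norm_triangle_ineq2[of "\<mu> ^ n" 1] by simp
    ultimately show ?thesis using 2 \<eta>n by (simp add: norm_power)
  next
    case 3
    have "\<gamma> / real (2 * n) ^ 2 \<le> 2" using n2 \<gamma> by (simp add: power_mult_distrib divide_le_eq)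
    moreover have "\<gamma> / real (2 * n) ^ 2 * norm \<mu> ^ (2 * n)
        \<le> norm (\<mu> ^ (2 * n) - of_real (norm \<mu>) ^ (2 * n))"
      by (rule 3[rule_format]) (use n in simp)
    then have "\<gamma> / real (2 * n) ^ 2 * norm (\<mu> ^ n) ^ 2
        \<le> norm ((\<mu> ^ n) ^ 2 - of_real (norm (\<mu> ^ n)) ^ 2)"
      by (simp add: norm_power power_mult[symmetric] mult.commute)
    ultimately have "\<gamma> / real (2 * n) ^ 2 / 2 \<le> norm (\<mu> ^ n - 1)"
      by (intro norm_minus_1_ge_ray)
    moreover have "\<gamma> / real (2 * n) ^ 2 / 2 = \<gamma> / 8 / real n ^ 2" by (simp add: power_mult_distrib)
    moreover have "min \<eta> (\<gamma> / 8) / real n ^ 2 \<le> \<gamma> / 8 / real n ^ 2"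
      by (intro divide_right_mono) auto
    ultimately show ?thesis by linarith
  qed
qed

text \<open>The radius has to shrink only polynomially in \<open>k\<close>. Powers are Lipschitz with an exponentially large constant
  away from the unit disk, but once \<open>\<bar>\<nu>\<bar> \<ge> 1 + 1 / n\<close> the divisor is at least \<open>1\<close> by Bernoulli's inequality, and below that
  modulus the constant for \<open>n\<close>-th powers is at most \<open>9 n\<close>, since \<open>(1 + 2 / n)\<^sup>n \<le> exp 2 \<le> 9\<close>.\<close>

lemma diophantine_neighbourhood:
  assumes \<mu>: "diophantine \<gamma> \<mu>" and \<gamma>: "0 < \<gamma>" "\<gamma> \<le> 1"
    and near: "norm (\<nu> - \<mu>) \<le> \<gamma> / (18 * real k ^ 3)" and n: "1 \<le> n" "n \<le> k"
  shows "\<gamma> / 2 / real n ^ 2 \<le> norm (\<nu> ^ n - 1)"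
proof (cases "1 + 1 / real n \<le> norm \<nu>")
  case True
  have "2 = 1 + real n * (1 / real n)" using n by simp
  also have "\<dots> \<le> (1 + 1 / real n) ^ n" by (rule Bernoulli_inequality) (simp add: order_trans[of _ 0])
  also have "\<dots> \<le> norm \<nu> ^ n" using True by (intro power_mono) auto
  finally have "1 \<le> norm (\<nu> ^ n - 1)"
    using norm_triangle_ineq2[of "\<nu> ^ n" 1] by (simp add: norm_power)
  moreover have "\<gamma> / 2 / real n ^ 2 \<le> 1"
  proof -
    have "1 \<le> real n ^ 2" using n by (simp add: one_le_power)
    then show ?thesis using \<gamma> by (simp add: divide_le_eq)
  qed
  ultimately show ?thesis by linarith
next
  case False
  define s where "s = 1 + 2 / real n"
  have s: "1 \<le> s" by (simp add: s_def)
  have n3: "real n \<le> real k ^ 3"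
  proof -
    have "real n \<le> real k ^ 1" using n by simp
    also have "\<dots> \<le> real k ^ 3" using n by (intro power_increasing) auto
    finally show ?thesis .
  qed
  have "norm (\<nu> - \<mu>) \<le> 1 / real n"
  proof -
    have "real n \<le> 18 * real k ^ 3" using n3 by linarith
    then have "\<gamma> / (18 * real k ^ 3) \<le> 1 / real n"
      using \<gamma> n by (intro frac_le) auto
    then show ?thesis using near by linarith
  qed
  then have norms: "norm \<nu> \<le> s" "norm \<mu> \<le> s"
    using False norm_triangle_ineq3[of \<nu> \<mu>] by (auto simp: s_def abs_le_iff)
  have s9: "s ^ n \<le> 9"
  proof -
    have "s ^ n \<le> exp (2 / real n) ^ n"
      using s exp_ge_add_one_self[of "2 / real n"] by (intro power_mono) (auto simp: s_def)
    also have "\<dots> = exp 1 ^ 2" using n by (simp flip: exp_of_nat_mult)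
    also have "\<dots> \<le> 3 ^ 2" using exp_le by (intro power_mono) auto
    finally show ?thesis by simp
  qed
  have "\<nu> ^ n - \<mu> ^ n = of_real (s ^ n) * ((\<nu> / of_real s) ^ n - (\<mu> / of_real s) ^ n)"
    using s by (simp add: power_divide right_diff_distrib)
  then have "norm (\<nu> ^ n - \<mu> ^ n) = s ^ n * norm ((\<nu> / of_real s) ^ n - (\<mu> / of_real s) ^ n)"
    using s by (simp add: norm_mult norm_power)
  also have "\<dots> \<le> s ^ n * (real n * norm (\<nu> / of_real s - \<mu> / of_real s))"
    using s norms by (intro mult_left_mono norm_power_diff) (auto simp: norm_divide)
  also have "\<dots> \<le> 9 * (real n * norm (\<nu> - \<mu>))"
  proof (intro mult_mono s9 order_refl)
    have "norm (\<nu> / of_real s - \<mu> / of_real s) = norm (\<nu> - \<mu>) / s"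
      using s by (simp add: norm_divide flip: diff_divide_distrib)
    also have "\<dots> \<le> norm (\<nu> - \<mu>)" using s divide_left_mono[of 1 s "norm (\<nu> - \<mu>)"] by simp
    finally show "norm (\<nu> / of_real s - \<mu> / of_real s) \<le> norm (\<nu> - \<mu>)" .
  qed auto
  also have "\<dots> \<le> 9 * (real k * (\<gamma> / (18 * real k ^ 3)))"
    using near n by (intro mult_left_mono mult_mono) auto
  also have "\<dots> = \<gamma> / 2 / real k ^ 2" using n by (simp add: power2_eq_square power3_eq_cube)
  also have "\<dots> \<le> \<gamma> / 2 / real n ^ 2"
    using n \<gamma> by (intro divide_left_mono power_mono mult_pos_pos) auto
  finally have "norm (\<nu> ^ n - \<mu> ^ n) \<le> \<gamma> / 2 / real n ^ 2" .
  moreover have "\<gamma> / real n ^ 2 \<le> norm (\<mu> ^ n - 1)" using \<mu> n by (simp add: diophantine_def)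
  moreover have "norm (\<mu> ^ n - 1) \<le> norm (\<nu> ^ n - 1) + norm (\<nu> ^ n - \<mu> ^ n)"
    using norm_triangle_ineq4[of "\<nu> ^ n - 1" "\<nu> ^ n - \<mu> ^ n"] by simp
  ultimately show ?thesis by (simp add: field_simps)
qed

section \<open>The coefficients as functions of the multiplier\<close>

lemma holomorphic_on_prod_list_map:
  assumes "\<And>e. e \<in> set es \<Longrightarrow> u e holomorphic_on U"
  shows "(\<lambda>\<mu>. prod_list (map (\<lambda>e. u e \<mu>) es)) holomorphic_on U"
  using assms by (induction es) (auto intro!: holomorphic_intros)

lemma composition_recursion_holomorphic:
  fixes h :: "nat \<Rightarrow> complex \<Rightarrow> complex"
  assumes base: "h 0 holomorphic_on U" "h 1 holomorphic_on U"
    and rec: "\<And>k \<mu>. 2 \<le> k \<Longrightarrow> k \<le> N \<Longrightarrow> \<mu> \<in> U \<Longrightarrow> h k \<mu> = d k \<mu> *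
      (\<Sum>j = 2..k. f j * (\<Sum>es\<in>pos_compositions j k. prod_list (map (\<lambda>e. h e \<mu>) es)))"
    and d: "\<And>k. 2 \<le> k \<Longrightarrow> k \<le> N \<Longrightarrow> d k holomorphic_on U"
    and k: "k \<le> N"
  shows "h k holomorphic_on U"
  using k
proof (induction k rule: less_induct)
  case (less k)
  consider "k = 0" | "k = 1" | "2 \<le> k" by linarith
  then show ?case
  proof cases
    case 3
    have "(\<lambda>\<mu>. d k \<mu> * (\<Sum>j = 2..k. f j *
        (\<Sum>es\<in>pos_compositions j k. prod_list (map (\<lambda>e. h e \<mu>) es)))) holomorphic_on U"
    proof (intro holomorphic_on_mult holomorphic_on_sum holomorphic_on_const
        holomorphic_on_prod_list_map)
      show "d k holomorphic_on U" using d[OF 3 less.prems] .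
      fix j es e assume "j \<in> {2..k}" "es \<in> pos_compositions j k" "e \<in> set es"
      then have "e < k" using pos_compositions_less by simp
      then show "h e holomorphic_on U" using less by simp
    qed
    then show ?thesis
      by (rule holomorphic_transform) (rule rec[OF 3 less.prems, symmetric])
  qed (use base in auto)
qed

lemma holomorphic_lin_coeff:
  assumes "\<And>n \<mu>. 1 \<le> n \<Longrightarrow> n < k \<Longrightarrow> \<mu> \<in> U \<Longrightarrow> \<mu> ^ n \<noteq> 1"
  shows "(\<lambda>\<mu>. lin_coeff f \<mu> k) holomorphic_on U"
proof (rule composition_recursion_holomorphic[where N = k and d = "\<lambda>i \<mu>. 1 / (\<mu> ^ (i - 1) - 1)"])
  fix i :: nat and \<mu> :: complex assume "2 \<le> i"
  then show "lin_coeff f \<mu> i = 1 / (\<mu> ^ (i - 1) - 1) *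
      (\<Sum>j = 2..i. f j * (\<Sum>es\<in>pos_compositions j i. prod_list (map (\<lambda>e. lin_coeff f \<mu> e) es)))"
    by (subst lin_coeff.simps) simp
next
  fix i :: nat assume i: "2 \<le> i" "i \<le> k"
  then show "(\<lambda>\<mu>. 1 / (\<mu> ^ (i - 1) - 1)) holomorphic_on U"
    using assms[of "i - 1"] by (intro holomorphic_intros) auto
qed (simp_all add: lin_coeff.simps)

definition coeff_at_infinity :: "(nat \<Rightarrow> complex) \<Rightarrow> nat \<Rightarrow> complex \<Rightarrow> complex" where
  "coeff_at_infinity f k w = fps_nth (linearization f (chart_at_infinity w)) k"

lemma coeff_at_infinity_0: "coeff_at_infinity f 0 w = 0"
  and coeff_at_infinity_1: "coeff_at_infinity f 1 w = 1"
  by (simp_all add: coeff_at_infinity_def linearization_def chart_at_infinity_def lin_coeff.simps)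

text \<open>The inverse divisor \<open>1 / (w\<^sup>-\<^sup>n - 1)\<close> extends to \<open>w = 0\<close> as \<open>w\<^sup>n / (1 - w\<^sup>n)\<close>, with value \<open>0\<close>, in agreement with
  the linearization \<open>z\<close> at infinity.\<close>

lemma coeff_at_infinity_rec:
  assumes k: "2 \<le> k"
  shows "coeff_at_infinity f k w = w ^ (k - 1) / (1 - w ^ (k - 1)) *
    (\<Sum>j = 2..k. f j * (\<Sum>es\<in>pos_compositions j k. prod_list (map (\<lambda>e. coeff_at_infinity f e w) es)))"
proof (cases "w = 0")
  case True
  then show ?thesis using k
    by (simp add: coeff_at_infinity_def linearization_def chart_at_infinity_def)
next
  case False
  have "1 / ((1 / w) ^ (k - 1) - 1) = w ^ (k - 1) / (1 - w ^ (k - 1))"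
    using False by (simp add: power_one_over divide_simps)
  moreover have "(\<lambda>e. coeff_at_infinity f e w) = lin_coeff f (1 / w)"
    using False by (simp add: coeff_at_infinity_def linearization_def chart_at_infinity_def fun_eq_iff)
  moreover have "coeff_at_infinity f k w = lin_coeff f (1 / w) k"
    using False by (simp add: coeff_at_infinity_def linearization_def chart_at_infinity_def)
  ultimately show ?thesis using k by (simp only:) (subst lin_coeff.simps, simp)
qed

lemma holomorphic_coeff_at_infinity: "coeff_at_infinity f k holomorphic_on ball 0 1"
proof (rule composition_recursion_holomorphic[where N = k and d = "\<lambda>i w. w ^ (i - 1) / (1 - w ^ (i - 1))"])
  fix i :: nat assume "2 \<le> i"
  have "w ^ (i - 1) \<noteq> 1" if "norm w < 1" for w :: complex
  proof -
    have "norm w ^ (i - 1) \<le> norm w ^ 1"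
      using \<open>2 \<le> i\<close> that by (intro power_decreasing) auto
    then have "norm (w ^ (i - 1)) < 1" using that by (simp add: norm_power)
    then show ?thesis by auto
  qed
  then show "(\<lambda>w. w ^ (i - 1) / (1 - w ^ (i - 1))) holomorphic_on ball 0 1"
    by (intro holomorphic_intros) auto
qed (auto simp: coeff_at_infinity_0[abs_def] coeff_at_infinity_1[abs_def, simplified] coeff_at_infinity_rec)

lemma coeff_at_infinity_bound:
  assumes B: "1 \<le> B" "\<And>j. 2 \<le> j \<Longrightarrow> norm (f j) \<le> B ^ (j - 1)" and w: "norm w \<le> 1 / 2"
  shows "norm (coeff_at_infinity f k w) \<le> (20 * B) ^ k"
proof (cases "k = 0")
  case False
  have "norm (coeff_at_infinity f k w) \<le> 2 * 1 * (10 * B) ^ (k - 1)"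
  proof (rule weighted_majorant_bound[where N = k and W = "\<lambda>_. 1" and d = "\<lambda>i. w ^ (i - 1) / (1 - w ^ (i - 1))"
      and h = "\<lambda>k. coeff_at_infinity f k w" and f = f])
    fix i j :: nat and es assume "2 \<le> j" "j \<le> i"
    then have "norm w ^ (i - 1) \<le> norm w ^ 1" using w by (intro power_decreasing) auto
    then have le: "norm (w ^ (i - 1)) \<le> 1 / 2" using w by (simp add: norm_power)
    moreover have "1 - norm (w ^ (i - 1)) \<le> norm (1 - w ^ (i - 1))"
      using norm_triangle_ineq2[of 1 "w ^ (i - 1)"] by simp
    ultimately have "norm (w ^ (i - 1)) / norm (1 - w ^ (i - 1)) \<le> 1" by (simp add: divide_le_eq)
    then show "norm (w ^ (i - 1) / (1 - w ^ (i - 1))) * prod_list (map (\<lambda>_. 1) es) \<le> 2 * 1"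
      by (simp add: norm_divide map_replicate_const)
  qed (use B False in \<open>auto simp: coeff_at_infinity_rec coeff_at_infinity_1[simplified]\<close>)
  also have "\<dots> \<le> 2 ^ k * (10 * B) ^ k"
  proof (intro mult_mono)
    show "(2 * 1 :: real) \<le> 2 ^ k" using False by (cases k) auto
    show "(10 * B) ^ (k - 1) \<le> (10 * B) ^ k" using B by (intro power_increasing) auto
  qed (use B in auto)
  also have "\<dots> = (20 * B) ^ k" unfolding power_mult_distrib[symmetric] by simp
  finally show ?thesis .
qed (simp add: coeff_at_infinity_0)

text \<open>Convergence at \<open>1 / 2\<close> gives \<open>\<bar>f\<^sub>j\<bar> \<le> M 2\<^sup>j\<close>; for \<open>j \<ge> 2\<close> the constant can be moved into the base
  even with the exponent \<open>j - 1\<close>.\<close>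

lemma univalent_coeff_bound:
  assumes "univalent_on_unit_disk (germ f 1)"
  obtains B where "1 \<le> B" "\<And>j. 2 \<le> j \<Longrightarrow> norm (f j) \<le> B ^ (j - 1)"
proof -
  let ?F = "germ f 1"
  have "ereal (norm (1 / 2 :: complex)) < 1" by simp
  also have "1 \<le> fps_conv_radius ?F" using assms by (simp add: univalent_on_unit_disk_def)
  finally have "summable (\<lambda>n. fps_nth ?F n * (1 / 2) ^ n)" by (rule summable_fps)
  then have "bounded (range (\<lambda>n. fps_nth ?F n * (1 / 2) ^ n))"
    using summable_imp_bounded by blast
  then obtain M where M: "\<And>n. norm (fps_nth ?F n * (1 / 2) ^ n) \<le> M"
    by (auto simp: bounded_iff)
  define B where "B = 4 * max 1 M"
  have "norm (f j) \<le> B ^ (j - 1)" if j: "2 \<le> j" for j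
  proof -
    obtain i where i: "j = Suc (Suc i)" using j by (metis Suc_le_D numeral_2_eq_2 Suc_le_mono)
    have "norm (f j) = norm (fps_nth ?F j * (1 / 2) ^ j) * 2 ^ j"
      using j by (simp add: germ_def norm_mult norm_power norm_divide power_divide)
    also have "\<dots> \<le> max 1 M * 2 ^ j" using M[of j] by (intro mult_right_mono) auto
    also have "\<dots> \<le> max 1 M ^ Suc i * 4 ^ Suc i"
    proof (intro mult_mono)
      show "max 1 M \<le> max 1 M ^ Suc i" by (rule self_le_power) auto
      show "(2 :: real) ^ j \<le> 4 ^ Suc i"
        using power_increasing[of j "2 * Suc i" "2 :: real"] by (simp add: i power_mult)
    qed auto
    also have "\<dots> = B ^ (j - 1)" by (simp add: B_def i power_mult_distrib)
    finally show ?thesis .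
  qed
  moreover have "1 \<le> B" by (simp add: B_def)
  ultimately show ?thesis using that by blast
qed

section \<open>Compactification\<close>

lemma closedin_riemann_sphere:
  assumes "closed R" shows "closedin riemann_sphere (insert None (Some ` R))"
proof -
  have "insert None (Some ` R) = topspace riemann_sphere - Some ` (- R)"
    by (auto simp: riemann_sphere_def)
  then show ?thesis
    using assms unfolding riemann_sphere_def closedin_Alexandroff_compactification
    by (metis open_Compl open_openin)
qed

text \<open>Infinity is a limit point of every unbounded set.\<close>

lemma connectedin_riemann_sphere:
  assumes "connected R" "\<not> bounded R"
  shows "connectedin riemann_sphere (insert None (Some ` R))"
proof (rule connectedin_intermediate_closure_of)
  show "connectedin riemann_sphere (Some ` R)"
    unfolding riemann_sphere_def
    using assms(1) by (intro connectedin_continuous_map_image[OF continuous_map_Some]) simp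
  have "None \<in> riemann_sphere closure_of (Some ` R)"
    unfolding in_closure_of
  proof (intro conjI allI impI)
    show "None \<in> topspace riemann_sphere" by (simp add: riemann_sphere_def)
    fix T assume "None \<in> T \<and> openin riemann_sphere T"
    then obtain K where K: "compact K" "T = insert None (Some ` (- K))"
      unfolding riemann_sphere_def openin_Alexandroff_compactification
      by (auto simp: Compl_eq_Diff_UNIV)
    then have "\<not> R \<subseteq> K" using assms(2) bounded_subset compact_imp_bounded by blast
    then show "\<exists>y. y \<in> Some ` R \<and> y \<in> T" using K by auto
  qed
  moreover have "Some ` R \<subseteq> riemann_sphere closure_of (Some ` R)"
    by (rule closure_of_subset) (auto simp: riemann_sphere_def)
  ultimately show "insert None (Some ` R) \<subseteq> riemann_sphere closure_of (Some ` R)" by simp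
qed auto

section \<open>Regular dependence on the multiplier\<close>

theorem theoremA:
  fixes f :: "nat \<Rightarrow> complex" and \<epsilon> :: real
  assumes "\<And>\<mu>. \<mu> \<noteq> 0 \<Longrightarrow> univalent_on_unit_disk (germ f \<mu>)"
    and "\<epsilon> > 0"
  shows "\<exists>\<rho>>0. \<exists>Cstar C :: complex option set.
    closedin riemann_sphere Cstar \<and> connectedin riemann_sphere Cstar \<and>
    closedin riemann_sphere C \<and> connectedin riemann_sphere C \<and>
    Cstar \<subseteq> C \<and>
    emeasure lborel {z. Some z \<notin> Cstar} \<le> ennreal \<epsilon> \<and>
    emeasure arc_length {z \<in> sphere 0 1. Some z \<in> C} \<ge> ennreal (2 * pi - \<epsilon>) \<and>
    linearization_defined_on f \<rho> C \<and>
    C1_hol_sphere C (Hinf \<rho>) (Hinf_norm \<rho>) (\<lambda>p. eval_fps (linearization f p)) \<and>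
    Cinf_hol_sphere Cstar (Hinf \<rho>) (Hinf_norm \<rho>) (\<lambda>p. eval_fps (linearization f p))"
proof -
  obtain B where B: "1 \<le> B" "\<And>j. 2 \<le> j \<Longrightarrow> norm (f j) \<le> B ^ (j - 1)"
    using univalent_coeff_bound[OF assms(1)] by (metis zero_neq_one)
  \<comment> \<open>Replacing \<open>\<epsilon>\<close> by \<open>min \<epsilon> 1\<close> ensures that some Diophantine point exists on the circle.\<close>
  obtain \<gamma> where \<gamma>: "0 < \<gamma>" "\<gamma> \<le> 1"
    and arc: "ennreal (2 * pi - min \<epsilon> 1) \<le> emeasure arc_length {z \<in> sphere 0 1. diophantine \<gamma> z}"
    using arc_length_diophantine[of "min \<epsilon> 1"] assms(2) by auto
  define \<eta> where "\<eta> = min (1 / 2) (\<epsilon> / (4 * pi))"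
  have \<eta>: "0 < \<eta>" "\<eta> < 1" and \<eta>\<epsilon>: "4 * pi * \<eta> \<le> \<epsilon>"
    using assms(2) by (auto simp: \<eta>_def min_def field_simps)
  define R where "R = nonresonant \<gamma> \<eta>"
  define C where "C = insert None (Some ` R)"
  have C_iff: "Some \<mu> \<in> C \<longleftrightarrow> \<mu> \<in> R" for \<mu> by (auto simp: C_def)
  define \<gamma>' where "\<gamma>' = min \<eta> (\<gamma> / 8)"
  have \<gamma>': "0 < \<gamma>'" "\<gamma>' \<le> 1" using \<gamma> \<eta> by (auto simp: \<gamma>'_def)
  have R_dioph: "diophantine \<gamma>' \<mu>" if "\<mu> \<in> R" for \<mu>
    using nonresonant_imp_diophantine \<gamma> \<eta> that unfolding R_def \<gamma>'_def by blast
  obtain A0 where A0: "1 \<le> A0" "\<And>\<mu> k. (\<And>n. 1 \<le> n \<Longrightarrow> n < k \<Longrightarrow> \<gamma>' / 2 / real n ^ 2 \<le> norm (\<mu> ^ n - 1))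
      \<Longrightarrow> norm (lin_coeff f \<mu> k) \<le> A0 ^ k"
    using siegel_estimate[OF B, of "\<gamma>' / 2"] \<gamma>' by auto
  define A where "A = max A0 (20 * B)"
  have A: "1 \<le> A" "A0 \<le> A" "20 * B \<le> A" using A0 by (auto simp: A_def)
  define \<rho> where "\<rho> = 1 / (2 * A)"
  have \<rho>: "0 < \<rho>" and A\<rho>: "A * \<rho> = 1 / 2" using A by (auto simp: \<rho>_def)
  \<comment> \<open>The shift to \<open>k + 1\<close> keeps the radius positive at \<open>k = 0\<close>.\<close>
  define \<delta> where "\<delta> = (\<lambda>k. \<gamma>' / (18 * real (k + 1) ^ 3))"
  have \<delta>: "0 < \<delta> k" for k using \<gamma>' by (simp add: \<delta>_def)
  have divisors: "\<gamma>' / 2 / real n ^ 2 \<le> norm (\<nu> ^ n - 1)"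
    if "\<mu> \<in> R" "\<nu> \<in> ball \<mu> (\<delta> k)" "1 \<le> n" "n < k" for \<mu> \<nu> n k
    using that by (intro diophantine_neighbourhood[OF R_dioph \<gamma>', of \<mu> \<nu> "k + 1"])
      (auto simp: \<delta>_def dist_norm norm_minus_commute)
  have bound: "norm (lin_coeff f \<nu> k) \<le> A ^ k" if "\<mu> \<in> R" "\<nu> \<in> ball \<mu> (\<delta> k)" for \<mu> \<nu> k
  proof -
    have "norm (lin_coeff f \<nu> k) \<le> A0 ^ k" using divisors[OF that] by (rule A0(2))
    also have "\<dots> \<le> A ^ k" using A A0(1) by (intro power_mono) auto
    finally show ?thesis .
  qed
  have finite_part: "Cinf_hol R (Hinf \<rho>) (Hinf_norm \<rho>) (\<lambda>\<mu>. eval_fps (Abs_fps (\<lambda>k. lin_coeff f \<mu> k)))"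
  proof (rule Cinf_hol_power_series[OF \<rho> \<delta>, where A = A])
    fix p
    have "summable (\<lambda>k. (18 / \<gamma>') ^ p * ((1 / 2) ^ k * real (k + 1) ^ (3 * p)))"
      by (intro summable_mult summable_power_times_polynomial)
    moreover have "(A * \<rho>) ^ k / \<delta> k ^ p = (18 / \<gamma>') ^ p * ((1 / 2) ^ k * real (k + 1) ^ (3 * p))" for k
      unfolding A\<rho> by (simp add: \<delta>_def power_divide power_mult_distrib power_mult)
    ultimately show "summable (\<lambda>k. (A * \<rho>) ^ k / \<delta> k ^ p)" by simp
  next
    fix \<mu> k assume \<mu>: "\<mu> \<in> R"
    show "(\<lambda>\<mu>. lin_coeff f \<mu> k) holomorphic_on ball \<mu> (\<delta> k)"
    proof (rule holomorphic_lin_coeff)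
      fix n \<nu> assume n: "1 \<le> n" "n < k" and \<nu>: "\<nu> \<in> ball \<mu> (\<delta> k)"
      have "0 < \<gamma>' / 2 / real n ^ 2" using n \<gamma>' by simp
      then show "\<nu> ^ n \<noteq> 1" using divisors[OF \<mu> \<nu> n] by auto
    qed
  qed (rule bound)
  have infinite_part: "Cinf_hol {w. norm w < 1 / 4 \<and> chart_at_infinity w \<in> C} (Hinf \<rho>) (Hinf_norm \<rho>)
      (\<lambda>w. eval_fps (Abs_fps (\<lambda>k. coeff_at_infinity f k w)))"
  proof (rule Cinf_hol_power_series[OF \<rho>, where A = A and \<delta> = "\<lambda>_. 1 / 4"])
    fix p
    show "summable (\<lambda>k. (A * \<rho>) ^ k / (1 / 4) ^ p)"
      unfolding A\<rho> by (intro summable_divide summable_geometric) simp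
  next
    fix \<mu> :: complex and k assume "\<mu> \<in> {w. norm w < 1 / 4 \<and> chart_at_infinity w \<in> C}"
    then have half: "norm \<nu> < 1 / 2" if "\<nu> \<in> ball \<mu> (1 / 4)" for \<nu>
      using that norm_triangle_sub[of \<nu> \<mu>] by (simp add: dist_norm norm_minus_commute)
    show "coeff_at_infinity f k holomorphic_on ball \<mu> (1 / 4)"
      using half by (intro holomorphic_on_subset[OF holomorphic_coeff_at_infinity]) force
    fix \<nu> assume "\<nu> \<in> ball \<mu> (1 / 4)"
    then have "norm (coeff_at_infinity f k \<nu>) \<le> (20 * B) ^ k"
      using half by (intro coeff_at_infinity_bound B) (auto simp: less_imp_le)
    also have "\<dots> \<le> A ^ k" using A B by (intro power_mono) auto
    finally show "norm (coeff_at_infinity f k \<nu>) \<le> A ^ k" .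
  qed simp
  have smooth: "Cinf_hol {\<mu>. Some \<mu> \<in> C} (Hinf \<rho>) (Hinf_norm \<rho>) ((\<lambda>p. eval_fps (linearization f p)) \<circ> Some)"
    using finite_part by (simp add: C_iff comp_def linearization_def)
  have smooth_inf: "Cinf_hol {w. norm w < 1 / 4 \<and> chart_at_infinity w \<in> C} (Hinf \<rho>) (Hinf_norm \<rho>)
      ((\<lambda>p. eval_fps (linearization f p)) \<circ> chart_at_infinity)"
    using infinite_part by (simp add: comp_def coeff_at_infinity_def fps_nth_inverse)
  have "Cinf_hol_sphere C (Hinf \<rho>) (Hinf_norm \<rho>) (\<lambda>p. eval_fps (linearization f p))"
    unfolding Cinf_hol_sphere_def using smooth smooth_inf
    by (intro conjI exI[of _ "1 / 4"]) auto
  moreover have "C1_hol_sphere C (Hinf \<rho>) (Hinf_norm \<rho>) (\<lambda>p. eval_fps (linearization f p))"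
    unfolding C1_hol_sphere_def using smooth smooth_inf
    by (intro conjI exI[of _ "1 / 4"] Cinf_hol_imp_C1_hol) auto
  moreover have "linearization_defined_on f \<rho> C"
    unfolding linearization_defined_on_def
  proof (intro conjI allI impI ballI)
    fix \<mu> assume "Some \<mu> \<in> C"
    then have \<mu>: "diophantine \<gamma>' \<mu>" using R_dioph C_iff by blast
    show "\<not> root_of_unity \<mu>"
    proof
      assume "root_of_unity \<mu>"
      then obtain n where n: "0 < n" "\<mu> ^ n = 1" by (auto simp: root_of_unity_def)
      have "\<gamma>' / real n ^ 2 \<le> norm (\<mu> ^ n - 1)"
        using \<mu> n(1) by (simp add: diophantine_def Suc_le_eq)
      moreover have "0 < \<gamma>' / real n ^ 2" using n \<gamma>' by simp
      ultimately show False using n by simp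
    qed
  next
    fix p assume p: "p \<in> C"
    show "ereal \<rho> \<le> fps_conv_radius (linearization f p)"
    proof (cases p)
      case None
      then show ?thesis by (simp add: linearization_def)
    next
      case (Some \<mu>)
      then have \<mu>: "\<mu> \<in> R" using p C_iff by simp
      have "summable (\<lambda>k. norm (lin_coeff f \<mu> k) * \<rho> ^ k)"
      proof (rule summable_comparison_test')
        show "summable (\<lambda>k. (A * \<rho>) ^ k)" unfolding A\<rho> by (intro summable_geometric) simp
        show "norm (norm (lin_coeff f \<mu> k) * \<rho> ^ k) \<le> (A * \<rho>) ^ k" for k
          using bound[OF \<mu>, of \<mu> k] \<delta>[of k] \<rho> by (simp add: power_mult_distrib mult_right_mono)
      qed
      then show ?thesis
        using conv_radius_ge_of_abs_summable[OF \<rho>] Some by (simp add: linearization_def)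
    qed
  qed
  moreover have "closedin riemann_sphere C"
    unfolding C_def R_def by (intro closedin_riemann_sphere closed_nonresonant)
  moreover have "connectedin riemann_sphere C"
    unfolding C_def
  proof (rule connectedin_riemann_sphere)
    have "{z \<in> sphere 0 1. diophantine \<gamma> z} \<noteq> {}"
    proof
      assume empty: "{z \<in> sphere 0 1. diophantine \<gamma> z} = {}"
      have "ennreal (2 * pi - min \<epsilon> 1) \<le> 0" using arc unfolding empty emeasure_empty .
      then show False using pi_gt3 by (simp add: min_def split: if_splits)
    qed
    then obtain \<zeta> where "diophantine \<gamma> \<zeta>" "norm \<zeta> = 1" by auto
    then show "connected R" unfolding R_def using \<eta> by (rule connected_nonresonant)
    show "\<not> bounded R"
    proof
      assume "bounded R"
      then obtain b where b: "\<And>\<mu>. \<mu> \<in> R \<Longrightarrow> norm \<mu> \<le> b" by (auto simp: bounded_iff)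
      have "1 + \<eta> \<le> norm (of_real (2 + \<bar>b\<bar>) :: complex)"
        using \<eta> by (simp del: of_real_add)
      then have "of_real (2 + \<bar>b\<bar>) \<in> R" unfolding R_def nonresonant_def by blast
      from b[OF this] show False by (simp del: of_real_add)
    qed
  qed
  moreover have "emeasure lborel {z. Some z \<notin> C} \<le> ennreal \<epsilon>"
  proof -
    have "emeasure lborel {z. Some z \<notin> C} \<le> emeasure lborel {z :: complex. 1 - \<eta> < norm z \<and> norm z < 1 + \<eta>}"
    proof (rule emeasure_mono)
      show "{z. Some z \<notin> C} \<subseteq> {z. 1 - \<eta> < norm z \<and> norm z < 1 + \<eta>}"
        by (auto simp: C_iff R_def nonresonant_def)
      have "open {z :: complex. 1 - \<eta> < norm z \<and> norm z < 1 + \<eta>}"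
        by (intro open_Collect_conj open_Collect_less) (auto intro!: continuous_intros)
      then show "{z :: complex. 1 - \<eta> < norm z \<and> norm z < 1 + \<eta>} \<in> sets lborel" by simp
    qed
    also have "\<dots> \<le> ennreal (4 * pi * \<eta>)" by (rule annulus_area[OF \<eta>])
    also have "\<dots> \<le> ennreal \<epsilon>" using \<eta>\<epsilon> by (rule ennreal_leI)
    finally show ?thesis .
  qed
  moreover have "ennreal (2 * pi - \<epsilon>) \<le> emeasure arc_length {z \<in> sphere 0 1. Some z \<in> C}"
  proof -
    have "ennreal (2 * pi - \<epsilon>) \<le> ennreal (2 * pi - min \<epsilon> 1)" by (intro ennreal_leI) simp
    also note arc
    also have "emeasure arc_length {z \<in> sphere 0 1. diophantine \<gamma> z}
        \<le> emeasure arc_length {z \<in> sphere 0 1. Some z \<in> C}"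
    proof (rule emeasure_mono)
      show "{z \<in> sphere 0 1. diophantine \<gamma> z} \<subseteq> {z \<in> sphere 0 1. Some z \<in> C}"
        using nonresonant_ray[of \<gamma> _ 1 \<eta>] by (auto simp: C_iff R_def)
      have "{z \<in> sphere 0 1. Some z \<in> C} = sphere 0 1 \<inter> R" by (auto simp: C_iff)
      moreover have "closed (sphere 0 1 \<inter> R)"
        unfolding R_def by (intro closed_Int closed_sphere closed_nonresonant)
      ultimately show "{z \<in> sphere 0 1. Some z \<in> C} \<in> sets arc_length" by (simp add: arc_length_def)
    qed
    finally show ?thesis .
  qed
  ultimately show ?thesis using \<rho> by (intro exI[of _ \<rho>] exI[of _ C] conjI) auto
qed

end
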